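(* For every integer $n\ge 1$, there exists a non-zero biharmonic polynomial $u_n:\mathbb{R}^2\to\mathbb{R}$ such that the nodal set $u_n^{-1}(0)$ contains $n$ nested smooth loops; that is, there are $n$ pairwise disjoint smooth loops $L_1,\dots,L_n\subset u_n^{-1}(0)$ such that, for each $k=1,\dots,n-1$, the loop $L_k$ lies inside the bounded domain enclosed by $L_{k+1}$.
   Context: A function $u$ on $\mathbb{R}^2$ is biharmonic if $\Delta\Delta u=0$, where $\Delta$ is the Laplacian. A biharmonic polynomial is a real polynomial in two variables that is biharmonic. A smooth loop is a smooth Jordan curve in $\mathbb{R}^2$, i.e. a smoothly embedded closed curve (a subset diffeomorphic to the circle, embedded as a $C^\infty$ submanifold of $\mathbb{R}^2$). The domain enclosed (bounded) by a loop is the bounded connected component of its complement. *)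

theory Defs
  imports "HOL-Analysis.Analysis"
begin

definition partial_deriv :: "'n \<Rightarrow> (real ^ 'n \<Rightarrow> real) \<Rightarrow> real ^ 'n \<Rightarrow> real" where
  "partial_deriv i f x = deriv (\<lambda>t. f (x + t *\<^sub>R axis i 1)) 0"

definition laplacian :: "(real ^ 'n \<Rightarrow> real) \<Rightarrow> real ^ 'n \<Rightarrow> real" where
  "laplacian f x = (\<Sum>i\<in>UNIV. partial_deriv i (partial_deriv i f) x)"

text \<open>
  The operator \<^const>\<open>deriv\<close> is total, so \<^const>\<open>laplacian\<close> is meaningful only for functions
  whose derivatives exist. It is applied below only to polynomial functions, which are smooth.
\<close>

definition biharmonic_polynomial :: "(real ^ 2 \<Rightarrow> real) \<Rightarrow> bool" where
  "biharmonic_polynomial u \<longleftrightarrow>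
     real_polynomial_function u \<and> (\<forall>x. laplacian (laplacian u) x = 0)"

definition smooth_curve :: "(real \<Rightarrow> real ^ 2) \<Rightarrow> bool" where
  "smooth_curve \<gamma> \<longleftrightarrow>
     (\<forall>k t. ((\<lambda>g s. vector_derivative g (at s)) ^^ k) \<gamma> differentiable at t)"

text \<open>
  A smooth loop is the image of a smooth embedding of the circle, taken as the quotient of the
  real line by the integers: smooth maps on it are the smooth maps of period 1, and since the
  circle is compact, embeddings are the same as injective immersions.
\<close>

definition smooth_loop :: "(real ^ 2) set \<Rightarrow> bool" where
  "smooth_loop L \<longleftrightarrow>
     (\<exists>\<gamma>. smooth_curve \<gamma> \<and> (\<forall>t. \<gamma> (t + 1) = \<gamma> t) \<and> inj_on \<gamma> {0..<1} \<and>
          (\<forall>t. vector_derivative \<gamma> (at t) \<noteq> 0) \<and> L = range \<gamma>)"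

end

theory Submission
  imports Defs
begin

text \<open>
  For polynomials $p, q$ the function $\mathrm{Re}\,(e^z p(\varepsilon z)) - \mathrm{Im}\, z\;\mathrm{Im}\,(e^z q(\varepsilon z))$
  is biharmonic. With $z = X / \varepsilon + i y$ and after division by the positive factor $e^{X / \varepsilon}$ it
  tends, as $\varepsilon \to 0$, to $v = p(X) \cos y - q(X)\, y \sin y$ in $C^1$ on compact sets of the
  $(X, y)$-plane. If $p + i q = (1 + i X^2)^M$ on the real line, then $v$ is the real part of
  $(1 + i X^2)^M (\cos y + i y \sin y)$, whose argument is $0$ at the origin and strictly increases along every ray
  to a limit of at least $M \pi / 2$. So the zero set of $v$ contains many nested star-shaped curves, on which
  $v$ has a nonzero radial derivative. They persist for small $\varepsilon$, also when $e^z$ is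
  replaced by a Taylor polynomial of large degree, and are smooth by implicit differentiation.
\<close>

section \<open>Biharmonic polynomials\<close>

text \<open>A nonzero harmonic polynomial vanishes on no loop, by the maximum principle, so the term
  with \<open>Im z\<close> is what makes loops possible. In the limit it replaces
  \<open>sin y\<close> by \<open>y * sin y\<close>, which makes the argument even in
  \<open>y\<close>; the square in \<open>1 + i X^2\<close> does the same for \<open>X\<close>. Hence
  the phase grows in every direction from the origin, and each further \<open>pi\<close> of phase
  yields one more loop. Along the \<open>X\<close>-axis \<open>arctan (X^2)\<close> stays bounded,
  and the power \<open>M\<close> compensates for this. Persistence rests on comparing the
  approximant \<open>f\<close> with the imaginary part \<open>lim_im\<close> of the limit.
  Positivity of \<open>f * lim_im' - lim_im * f'\<close> is an open condition that holds strictly on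
  a compact set of the limit. It makes \<open>f / lim_im\<close> strictly decreasing along a ray
  wherever \<open>lim_im\<close> is nonzero, so each band of phases around an odd multiple of
  \<open>pi / 2\<close> contains exactly one zero. Uniqueness gives continuity of the radius by a
  closed graph argument, and implicit differentiation then expresses its derivative rationally in
  known functions, so that it can be repeated. The choices are made in the order \<open>n\<close>,
  then \<open>M\<close> and the range \<open>S\<close> of radii, then \<open>e\<close>, then the
  Taylor degree \<open>N\<close>.\<close>

definition bih :: "complex poly \<Rightarrow> complex poly \<Rightarrow> complex \<Rightarrow> real" where
  "bih P Q z = Re (poly P z) + Im z * Im (poly Q z)"

definition dbih :: "complex poly \<Rightarrow> complex poly \<Rightarrow> complex \<Rightarrow> complex \<Rightarrow> real" where
  "dbih P Q z d = Re (poly (pderiv P) z * d) + Im d * Im (poly Q z) + Im z * Im (poly (pderiv Q) z * d)"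

lemma bih_has_real_derivative:
  assumes "(\<zeta> has_vector_derivative d) (at t)"
  shows "((\<lambda>t. bih P Q (\<zeta> t)) has_real_derivative dbih P Q (\<zeta> t) d) (at t)"
proof -
  have poly: "((\<lambda>t. poly R (\<zeta> t)) has_vector_derivative d * poly (pderiv R) (\<zeta> t)) (at t)" for R
    using field_vector_diff_chain_at[OF assms poly_DERIV[of R "\<zeta> t"]] by (simp add: o_def)
  note Re = bounded_linear.has_vector_derivative[OF bounded_linear_Re]
  note Im = bounded_linear.has_vector_derivative[OF bounded_linear_Im]
  note [derivative_intros] = Re[OF poly, folded has_real_derivative_iff_has_vector_derivative]
    Im[OF poly, folded has_real_derivative_iff_has_vector_derivative]
    Im[OF assms, folded has_real_derivative_iff_has_vector_derivative]
  show ?thesis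
    unfolding bih_def dbih_def
    by (auto intro!: derivative_eq_intros simp: mult.commute)
qed

lemma real_polynomial_bih:
  "real_polynomial_function (\<lambda>x :: real ^ 2. bih P Q (Complex (x $ 1) (x $ 2)))"
proof -
  have coord: "real_polynomial_function (\<lambda>x :: real ^ 2. x $ i)" for i
    by (intro real_polynomial_function.intros(1) bounded_linear_vec_nth)
  have "real_polynomial_function (\<lambda>x :: real ^ 2. Re (poly R (Complex (x $ 1) (x $ 2)))) \<and>
        real_polynomial_function (\<lambda>x :: real ^ 2. Im (poly R (Complex (x $ 1) (x $ 2))))" for R
    by (induction R) (auto intro!: real_polynomial_function.intros(2-4) coord)
  then show ?thesis
    unfolding bih_def complex.sel
    by (intro real_polynomial_function.intros(3,4) coord) auto
qed

text \<open>The family \<open>bih P Q\<close> is closed under partial derivatives. In the second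
  formula the extra \<open>- Q\<close> comes from differentiating the factor \<open>Im z\<close>,
  since \<open>Im Q = Re (- i Q)\<close>.\<close>

lemma partial_deriv_bih:
  fixes x :: "real ^ 2"
  shows "partial_deriv 1 (\<lambda>x :: real ^ 2. bih P Q (Complex (x $ 1) (x $ 2))) =
           (\<lambda>x. bih (pderiv P) (pderiv Q) (Complex (x $ 1) (x $ 2)))"
    and "partial_deriv 2 (\<lambda>x :: real ^ 2. bih P Q (Complex (x $ 1) (x $ 2))) =
           (\<lambda>x. bih (smult \<i> (pderiv P - Q)) (smult \<i> (pderiv Q)) (Complex (x $ 1) (x $ 2)))"
proof -
  have *: "partial_deriv i (\<lambda>x. bih P Q (Complex (x $ 1) (x $ 2))) x =
      dbih P Q (Complex (x $ 1) (x $ 2)) (Complex (axis i 1 $ 1) (axis i 1 $ 2))"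
    for i and x :: "real ^ 2"
  proof -
    let ?\<zeta> = "\<lambda>t. Complex (x $ 1) (x $ 2) + t *\<^sub>R Complex (axis i 1 $ 1) (axis i 1 $ 2)"
    have "(?\<zeta> has_vector_derivative Complex (axis i 1 $ 1) (axis i 1 $ 2)) (at 0)"
      by (auto intro!: derivative_eq_intros)
    from bih_has_real_derivative[OF this, of P Q]
    show ?thesis
      unfolding partial_deriv_def
      by (intro DERIV_imp_deriv) (simp add: complex_eq_iff scaleR_complex.code plus_complex.code)
  qed
  show "partial_deriv 1 (\<lambda>x :: real ^ 2. bih P Q (Complex (x $ 1) (x $ 2))) =
           (\<lambda>x. bih (pderiv P) (pderiv Q) (Complex (x $ 1) (x $ 2)))"
    by (rule ext, subst *) (simp add: axis_def dbih_def bih_def algebra_simps)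
  show "partial_deriv 2 (\<lambda>x :: real ^ 2. bih P Q (Complex (x $ 1) (x $ 2))) =
           (\<lambda>x. bih (smult \<i> (pderiv P - Q)) (smult \<i> (pderiv Q)) (Complex (x $ 1) (x $ 2)))"
    by (rule ext, subst *) (simp add: axis_def dbih_def bih_def algebra_simps)
qed

text \<open>In the sum of the two second derivatives \<open>P\<close> cancels up to
  \<open>2 Q'\<close> and \<open>Q\<close> cancels completely. The Laplacian is thus the real part
  of a polynomial, and applying the same formula with \<open>Q = 0\<close> gives zero.\<close>

lemma biharmonic_bih:
  "biharmonic_polynomial (\<lambda>x. bih P Q (Complex (x $ 1) (x $ 2)))"
proof -
  have "laplacian (\<lambda>x :: real ^ 2. bih P Q (Complex (x $ 1) (x $ 2))) =
      (\<lambda>x. bih (smult 2 (pderiv Q)) 0 (Complex (x $ 1) (x $ 2)))" for P Q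
    by (rule ext) (simp add: laplacian_def UNIV_2 partial_deriv_bih,
        simp add: bih_def pderiv_smult pderiv_diff algebra_simps)
  then show ?thesis
    by (simp add: biharmonic_polynomial_def real_polynomial_bih) (simp add: bih_def)
qed

section \<open>Smooth star-shaped curves\<close>

text \<open>The mean value theorem in the first variable alone gives \<open>- F (\<sigma> t) t' =
  (\<sigma> t' - \<sigma> t) * Fs \<xi> t'\<close> with \<open>\<xi>\<close> between
  \<open>\<sigma> t\<close> and \<open>\<sigma> t'\<close>. Dividing by \<open>t' - t\<close> and
  letting \<open>t'\<close> tend to \<open>t\<close> yields the formula, with the continuity of
  \<open>\<sigma>\<close> forcing \<open>\<xi>\<close> to converge.\<close>

lemma implicit_derivative:
  fixes F Fs :: "real \<Rightarrow> real \<Rightarrow> real"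
  assumes zero: "\<And>t. F (\<sigma> t) t = 0"
    and cont: "isCont \<sigma> t"
    and Fs: "\<And>s t. ((\<lambda>s. F s t) has_real_derivative Fs s t) (at s)"
    and contFs: "isCont (\<lambda>(s, t). Fs s t) (\<sigma> t, t)"
    and Ft: "((\<lambda>t'. F (\<sigma> t) t') has_real_derivative Ft) (at t)"
    and nz: "Fs (\<sigma> t) t \<noteq> 0"
  shows "(\<sigma> has_real_derivative - Ft / Fs (\<sigma> t) t) (at t)"
proof -
  have "\<exists>\<xi>. \<bar>\<xi> - \<sigma> t\<bar> \<le> \<bar>\<sigma> t' - \<sigma> t\<bar> \<and>
      F (\<sigma> t') t' - F (\<sigma> t) t' = (\<sigma> t' - \<sigma> t) * Fs \<xi> t'" for t'
  proof (cases "\<sigma> t'" "\<sigma> t" rule: linorder_cases)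
    case less
    from MVT2[OF this Fs] obtain z where "\<sigma> t' < z" "z < \<sigma> t"
      "F (\<sigma> t) t' - F (\<sigma> t') t' = (\<sigma> t - \<sigma> t') * Fs z t'" by blast
    then show ?thesis by (intro exI[of _ z]) (auto simp: algebra_simps)
  next
    case greater
    from MVT2[OF this Fs] obtain z where "\<sigma> t < z" "z < \<sigma> t'"
      "F (\<sigma> t') t' - F (\<sigma> t) t' = (\<sigma> t' - \<sigma> t) * Fs z t'" by blast
    then show ?thesis by (intro exI[of _ z]) auto
  qed auto
  then obtain \<xi> where \<xi>: "\<And>t'. \<bar>\<xi> t' - \<sigma> t\<bar> \<le> \<bar>\<sigma> t' - \<sigma> t\<bar>"
    "\<And>t'. F (\<sigma> t') t' - F (\<sigma> t) t' = (\<sigma> t' - \<sigma> t) * Fs (\<xi> t') t'" by metis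
  have \<sigma>: "(\<sigma> \<longlongrightarrow> \<sigma> t) (at t)"
    using cont by (simp add: isCont_def)
  have "((\<lambda>t'. \<xi> t' - \<sigma> t) \<longlongrightarrow> 0) (at t)"
    by (rule Lim_null_comparison[where g = "\<lambda>t'. \<bar>\<sigma> t' - \<sigma> t\<bar>"])
      (use \<xi>(1) tendsto_rabs_zero[OF LIM_zero[OF \<sigma>]] in auto)
  then have "(\<xi> \<longlongrightarrow> \<sigma> t) (at t)" by (rule LIM_zero_cancel)
  then have "((\<lambda>t'. (\<xi> t', t')) \<longlongrightarrow> (\<sigma> t, t)) (at t)"
    by (intro tendsto_intros)
  from isCont_tendsto_compose[OF contFs this]
  have lim: "((\<lambda>t'. Fs (\<xi> t') t') \<longlongrightarrow> Fs (\<sigma> t) t) (at t)" by simp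
  have "((\<lambda>t'. - ((F (\<sigma> t) t' - F (\<sigma> t) t) / (t' - t)) / Fs (\<xi> t') t') \<longlongrightarrow> - Ft / Fs (\<sigma> t) t) (at t)"
    using Ft nz by (intro tendsto_intros lim) (auto simp: has_field_derivative_iff)
  moreover have "\<forall>\<^sub>F t' in at t. Fs (\<xi> t') t' \<noteq> 0"
    using tendsto_imp_eventually_ne[OF lim nz] .
  then have "\<forall>\<^sub>F t' in at t. - ((F (\<sigma> t) t' - F (\<sigma> t) t) / (t' - t)) / Fs (\<xi> t') t' =
      (\<sigma> t' - \<sigma> t) / (t' - t)"
  proof eventually_elim
    case (elim t')
    have "F (\<sigma> t) t' = - ((\<sigma> t' - \<sigma> t) * Fs (\<xi> t') t')"
      using \<xi>(2)[of t'] zero[of t'] by simp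
    with elim zero[of t] show ?case by simp
  qed
  ultimately show ?thesis
    unfolding has_field_derivative_iff by (rule Lim_transform_eventually)
qed

text \<open>A device for infinite differentiability: if the derivative of every generator lies in
  this algebra, so does the derivative of every member. Reciprocals are included because implicit
  differentiation divides by \<open>Fs\<close>.\<close>

inductive_set diff_closure :: "(real \<Rightarrow> real) set \<Rightarrow> (real \<Rightarrow> real) set" for G where
  base: "f \<in> G \<Longrightarrow> f \<in> diff_closure G"
| const: "(\<lambda>t. c) \<in> diff_closure G"
| add: "f \<in> diff_closure G \<Longrightarrow> g \<in> diff_closure G \<Longrightarrow> (\<lambda>t. f t + g t) \<in> diff_closure G"
| mult: "f \<in> diff_closure G \<Longrightarrow> g \<in> diff_closure G \<Longrightarrow> (\<lambda>t. f t * g t) \<in> diff_closure G"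
| inverse: "f \<in> diff_closure G \<Longrightarrow> (\<And>t. f t \<noteq> 0) \<Longrightarrow> (\<lambda>t. inverse (f t)) \<in> diff_closure G"

lemma diff_closure_minus: "f \<in> diff_closure G \<Longrightarrow> (\<lambda>t. - f t) \<in> diff_closure G"
  using diff_closure.mult[OF diff_closure.const[of "-1"], of f G] by simp

lemma diff_closure_diff:
  "f \<in> diff_closure G \<Longrightarrow> g \<in> diff_closure G \<Longrightarrow> (\<lambda>t. f t - g t) \<in> diff_closure G"
  using diff_closure.add[OF _ diff_closure_minus, of f G g] by simp

lemma diff_closure_derivative:
  assumes G: "\<And>f. f \<in> G \<Longrightarrow> \<exists>f'\<in>diff_closure G. \<forall>t. (f has_real_derivative f' t) (at t)"
    and "f \<in> diff_closure G"
  shows "\<exists>f'\<in>diff_closure G. \<forall>t. (f has_real_derivative f' t) (at t)"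
  using assms(2)
proof induction
  case (const c)
  show ?case by (rule bexI[OF _ diff_closure.const[of 0]]) auto
next
  case (add f g)
  then obtain f' g' where "f' \<in> diff_closure G" "g' \<in> diff_closure G"
    and D: "\<And>t. (f has_real_derivative f' t) (at t)" "\<And>t. (g has_real_derivative g' t) (at t)" by blast
  then show ?case
    by (intro bexI[of _ "\<lambda>t. f' t + g' t"] diff_closure.add) (auto intro!: derivative_eq_intros D)
next
  case (mult f g)
  then obtain f' g' where "f' \<in> diff_closure G" "g' \<in> diff_closure G"
    and D: "\<And>t. (f has_real_derivative f' t) (at t)" "\<And>t. (g has_real_derivative g' t) (at t)" by blast
  with mult show ?case
    by (intro bexI[of _ "\<lambda>t. f t * g' t + f' t * g t"] diff_closure.add diff_closure.mult)
       (auto intro!: derivative_eq_intros D simp: algebra_simps)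
next
  case (inverse f)
  then obtain f' where "f' \<in> diff_closure G"
    and D: "\<And>t. (f has_real_derivative f' t) (at t)" by blast
  with inverse show ?case
    by (intro bexI[of _ "\<lambda>t. - (inverse (f t) * f' t * inverse (f t))"] diff_closure_minus
          diff_closure.mult diff_closure.inverse)
       (auto intro!: derivative_eq_intros D)
qed (use G in auto)

lemma has_vector_derivative_scaleR_add:
  assumes "(f has_real_derivative f') (at t)" "(g has_real_derivative g') (at t)"
  shows "((\<lambda>t. f t *\<^sub>R u + g t *\<^sub>R v) has_vector_derivative (f' *\<^sub>R u + g' *\<^sub>R v)) (at t)"
  by (auto intro!: derivative_eq_intros assms)

text \<open>Each vector derivative again has two coordinate functions in the closure, so induction
  on the order reaches all iterated derivatives.\<close>

lemma smooth_curve_diff_closure: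
  assumes G: "\<And>f. f \<in> G \<Longrightarrow> \<exists>f'\<in>diff_closure G. \<forall>t. (f has_real_derivative f' t) (at t)"
    and "f \<in> diff_closure G" "g \<in> diff_closure G"
  shows "smooth_curve (\<lambda>t. f t *\<^sub>R axis 1 1 + g t *\<^sub>R axis 2 1)"
proof -
  have step: "\<exists>f'\<in>diff_closure G. \<exists>g'\<in>diff_closure G. \<forall>t.
      ((\<lambda>t. f t *\<^sub>R axis 1 1 + g t *\<^sub>R axis 2 1 :: real ^ 2) has_vector_derivative
        (f' t *\<^sub>R axis 1 1 + g' t *\<^sub>R axis 2 1)) (at t)"
    if fg: "f \<in> diff_closure G" "g \<in> diff_closure G" for f g
  proof -
    obtain f' g' where "f' \<in> diff_closure G" "g' \<in> diff_closure G"
      and D: "\<And>t. (f has_real_derivative f' t) (at t)" "\<And>t. (g has_real_derivative g' t) (at t)"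
      using diff_closure_derivative[OF G] fg by metis
    then show ?thesis
      by (intro bexI[of _ f'] bexI[of _ g'] allI has_vector_derivative_scaleR_add D)
  qed
  have iterate: "\<exists>f\<in>diff_closure G. \<exists>g\<in>diff_closure G.
      ((\<lambda>g s. vector_derivative g (at s)) ^^ k) (\<lambda>t. f0 t *\<^sub>R axis 1 1 + g0 t *\<^sub>R axis 2 1 :: real ^ 2) =
      (\<lambda>t. f t *\<^sub>R axis 1 1 + g t *\<^sub>R axis 2 1)"
    if "f0 \<in> diff_closure G" "g0 \<in> diff_closure G" for k f0 g0
  proof (induction k)
    case 0
    then show ?case using that by auto
  next
    case (Suc k)
    then obtain f g where fg: "f \<in> diff_closure G" "g \<in> diff_closure G"
      and eq: "((\<lambda>g s. vector_derivative g (at s)) ^^ k) (\<lambda>t. f0 t *\<^sub>R axis 1 1 + g0 t *\<^sub>R axis 2 1 :: real ^ 2) =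
      (\<lambda>t. f t *\<^sub>R axis 1 1 + g t *\<^sub>R axis 2 1)" by blast
    from step[OF fg] obtain f' g' where "f' \<in> diff_closure G" "g' \<in> diff_closure G"
      and D: "\<And>t. ((\<lambda>t. f t *\<^sub>R axis 1 1 + g t *\<^sub>R axis 2 1 :: real ^ 2) has_vector_derivative
        (f' t *\<^sub>R axis 1 1 + g' t *\<^sub>R axis 2 1)) (at t)" by blast
    then show ?case
      by - (rule bexI[of _ f'], rule bexI[of _ g'], simp_all add: eq vector_derivative_at[OF D])
  qed
  show ?thesis
    unfolding smooth_curve_def
  proof (intro allI)
    fix k t
    obtain f' g' where "f' \<in> diff_closure G" "g' \<in> diff_closure G"
      and eq: "((\<lambda>g s. vector_derivative g (at s)) ^^ k) (\<lambda>t. f t *\<^sub>R axis 1 1 + g t *\<^sub>R axis 2 1 :: real ^ 2) =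
        (\<lambda>t. f' t *\<^sub>R axis 1 1 + g' t *\<^sub>R axis 2 1)"
      using iterate[OF assms(2,3)] by blast
    obtain f'' g'' where "((\<lambda>t. f' t *\<^sub>R axis 1 1 + g' t *\<^sub>R axis 2 1 :: real ^ 2) has_vector_derivative
        (f'' t *\<^sub>R axis 1 1 + g'' t *\<^sub>R axis 2 1)) (at t)"
      using step[OF \<open>f' \<in> diff_closure G\<close> \<open>g' \<in> diff_closure G\<close>] by blast
    then show "((\<lambda>g s. vector_derivative g (at s)) ^^ k) (\<lambda>t. f t *\<^sub>R axis 1 1 + g t *\<^sub>R axis 2 1 :: real ^ 2) differentiable at t"
      unfolding eq by (rule differentiableI_vector)
  qed
qed

text \<open>The points \<open>r *\<^sub>R \<gamma> t\<close> with \<open>r \<le> 1\<close> and those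
  with \<open>r \<ge> 1\<close> form two closed sets that cover the space and meet only on the
  curve. A component of the complement therefore lies in one of them, and the first one is
  compact.\<close>

lemma inside_star_curve:
  fixes \<gamma> :: "real \<Rightarrow> 'a::euclidean_space"
  assumes cont: "continuous_on UNIV \<gamma>"
    and per: "\<And>t. \<gamma> (t + 1) = \<gamma> t"
    and nz: "\<And>t. \<gamma> t \<noteq> 0"
    and cover: "\<And>x. \<exists>r\<ge>0. \<exists>t. x = r *\<^sub>R \<gamma> t"
    and radial: "\<And>t t' r. r > 0 \<Longrightarrow> \<gamma> t' = r *\<^sub>R \<gamma> t \<Longrightarrow> r = 1"
    and r: "0 \<le> r" "r < 1"
  shows "r *\<^sub>R \<gamma> t \<in> inside (range \<gamma>)"
proof -
  have frac: "\<gamma> (frac t) = \<gamma> t" for t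
  proof -
    have per_nat: "\<gamma> (t + real n) = \<gamma> t" for t n
    proof (induction n)
      case (Suc n)
      then show ?case using per[of "t + real n"] by (simp add: ac_simps)
    qed auto
    have "\<gamma> (t + of_int i) = \<gamma> t" for t i
      using per_nat[of t "nat i"] per_nat[of "t + of_int i" "nat (- i)"] by (cases "i \<ge> 0") auto
    from this[of "frac t" "\<lfloor>t\<rfloor>"] show ?thesis by (simp add: frac_def)
  qed
  have ex01: "\<exists>t'\<in>{0..1}. \<gamma> t = \<gamma> t'" for t
    using frac[of t] frac_ge_0[of t] frac_lt_1[of t] by (intro bexI[of _ "frac t"]) auto
  define C where "C a b = (\<lambda>(r, t). r *\<^sub>R \<gamma> t) ` ({a..b} \<times> {0..1})" for a b :: real
  have compact_C: "compact (C a b)" for a b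
    unfolding C_def
    by (intro compact_continuous_image compact_Times compact_Icc)
      (auto simp: case_prod_beta intro!: continuous_intros continuous_on_compose2[OF cont])
  have C_iff: "x \<in> C a b \<longleftrightarrow> (\<exists>r\<in>{a..b}. \<exists>t. x = r *\<^sub>R \<gamma> t)" for x a b
  proof
    assume "\<exists>r\<in>{a..b}. \<exists>t. x = r *\<^sub>R \<gamma> t"
    then obtain r t where "r \<in> {a..b}" "x = r *\<^sub>R \<gamma> t" by blast
    with ex01[of t] obtain t' where "t' \<in> {0..1}" "x = r *\<^sub>R \<gamma> t'" by auto
    with \<open>r \<in> {a..b}\<close> show "x \<in> C a b"
      unfolding C_def by (intro image_eqI[of _ _ "(r, t')"]) auto
  next
    assume "x \<in> C a b"
    then obtain p where "p \<in> {a..b} \<times> {0..1}" "x = fst p *\<^sub>R \<gamma> (snd p)"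
      unfolding C_def case_prod_beta by blast
    then have "fst p \<in> {a..b}" "x = fst p *\<^sub>R \<gamma> (snd p)" by auto
    then show "\<exists>r\<in>{a..b}. \<exists>t. x = r *\<^sub>R \<gamma> t" by blast
  qed
  define O' where "O' = {r *\<^sub>R \<gamma> t | r t. r \<ge> 1}"
  have C_I: "r *\<^sub>R \<gamma> t \<in> C a b" if "a \<le> r" "r \<le> b" for a b r t
    unfolding C_iff by (rule bexI[of _ r]) (use that in blast, use that in simp)
  have O_I: "r *\<^sub>R \<gamma> t \<in> O'" if "1 \<le> r" for r t
    unfolding O'_def using that by blast
  obtain m where m: "\<And>t. m \<le> norm (\<gamma> t)" "m > 0"
  proof -
    obtain t0 where "t0 \<in> {0..1}" "\<And>t. t \<in> {0..1} \<Longrightarrow> norm (\<gamma> t0) \<le> norm (\<gamma> t)"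
    proof -
      have "continuous_on {0..1} (\<lambda>t. norm (\<gamma> t))"
        by (intro continuous_on_norm continuous_on_subset[OF cont]) auto
      from continuous_attains_inf[OF compact_Icc _ this] that show thesis by auto
    qed
    then have "norm (\<gamma> t0) \<le> norm (\<gamma> t)" for t using ex01[of t] by auto
    then show thesis using that[of "norm (\<gamma> t0)"] nz by simp
  qed
  \<comment> \<open>A convergent sequence is bounded, and
    \<open>norm (\<gamma> t) \<ge> m > 0\<close> then bounds the factors \<open>r\<close>, so the
    sequence stays in one compact piece \<open>C 1 (B / m)\<close>.\<close>
  have "closed O'"
    unfolding closed_sequential_limits
  proof (intro allI impI, elim conjE)
    fix X l assume X: "\<forall>n. X n \<in> O'" and lim: "X \<longlonglongrightarrow> l"
    then have "bounded (range X)"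
      by (simp add: convergent_imp_bounded)
    then obtain B where B: "\<And>n. norm (X n) \<le> B" by (auto simp: bounded_iff)
    have "X n \<in> C 1 (B / m)" for n
    proof -
      from X have "X n \<in> O'" ..
      then obtain r t where rt: "r \<ge> 1" "X n = r *\<^sub>R \<gamma> t" unfolding O'_def by blast
      have "r * m \<le> r * norm (\<gamma> t)" using rt m by (intro mult_left_mono) auto
      also have "\<dots> \<le> B" using B[of n] rt by simp
      finally show ?thesis unfolding rt(2) using rt(1) m by (intro C_I) (simp_all add: field_simps)
    qed
    then have "l \<in> C 1 (B / m)"
      using compact_imp_closed[OF compact_C] lim by (metis closed_sequentially)
    then obtain r t where "r \<in> {1..B / m}" "l = r *\<^sub>R \<gamma> t" unfolding C_iff by blast
    then show "l \<in> O'" using O_I[of r t] by simp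
  qed
  have sep: "x \<in> range \<gamma>" if "x \<in> C 0 1" "x \<in> O'" for x
  proof -
    obtain r t where rt: "r \<in> {0..1}" "x = r *\<^sub>R \<gamma> t"
      using \<open>x \<in> C 0 1\<close> unfolding C_iff by (elim bexE exE)
    obtain r' t' where rt': "r' \<ge> 1" "x = r' *\<^sub>R \<gamma> t'"
      using \<open>x \<in> O'\<close> unfolding O'_def by (elim CollectE exE conjE)
    have e: "r' *\<^sub>R \<gamma> t' = r *\<^sub>R \<gamma> t" using rt rt' by simp
    have "r \<noteq> 0"
    proof
      assume "r = 0"
      with e rt' nz[of t'] show False by simp
    qed
    with rt have r0: "r > 0" by simp
    have "r' \<noteq> 0" using rt' by auto
    then have "\<gamma> t' = inverse r' *\<^sub>R (r' *\<^sub>R \<gamma> t')" by simp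
    then have "\<gamma> t' = (r / r') *\<^sub>R \<gamma> t" unfolding e by (simp add: divide_inverse mult.commute)
    from radial[OF _ this] r0 rt rt' have "r / r' = 1" by auto
    with rt rt' have "r = 1" by auto
    with rt show ?thesis by simp
  qed
  let ?x = "r *\<^sub>R \<gamma> t"
  have x: "?x \<in> C 0 1" using r by (intro C_I) simp_all
  have xO: "?x \<notin> range \<gamma>"
  proof
    assume "?x \<in> range \<gamma>"
    then obtain t' where t': "\<gamma> t' = r *\<^sub>R \<gamma> t" by auto
    then have "r > 0" using r nz[of t'] by (cases "r = 0") auto
    with radial[OF _ t'] r show False by auto
  qed
  let ?K = "connected_component_set (- range \<gamma>) ?x"
  have K: "?K \<subseteq> - range \<gamma>" by (rule connected_component_subset)
  have all: "x \<in> C 0 1 \<union> O'" for x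
  proof -
    from cover[of x] obtain r t where "r \<ge> 0" "x = r *\<^sub>R \<gamma> t" by blast
    then show ?thesis using C_I[of 0 r 1 t] O_I[of r t] by (cases "r \<le> 1") simp_all
  qed
  have "C 0 1 \<inter> O' \<inter> ?K = {}"
    using sep K by blast
  moreover have "?K \<subseteq> C 0 1 \<union> O'"
    using all by blast
  ultimately have "C 0 1 \<inter> ?K = {} \<or> O' \<inter> ?K = {}"
    by (intro connected_closedD connected_connected_component compact_imp_closed[OF compact_C] \<open>closed O'\<close>)
  moreover have "?x \<in> ?K" using xO by (simp add: connected_component_refl)
  ultimately have "O' \<inter> ?K = {}" using x by blast
  then have "?K \<subseteq> C 0 1" using all by blast
  then have "bounded ?K" using bounded_subset compact_imp_bounded[OF compact_C] by blast
  with xO show ?thesis by (simp add: inside_def)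
qed

section \<open>Star-shaped curves in stretched polar coordinates\<close>

lemma polar_cancel:
  fixes r r' :: real
  assumes "r > 0" "r' > 0" "c\<^sup>2 + s\<^sup>2 = 1" "c'\<^sup>2 + s'\<^sup>2 = 1" "r * c = r' * c'" "r * s = r' * s'"
  shows "r = r'" "c = c'" "s = s'"
proof -
  have "r\<^sup>2 = (r * c)\<^sup>2 + (r * s)\<^sup>2" using assms(3) by (simp add: power_mult_distrib flip: distrib_left)
  also have "\<dots> = r'\<^sup>2" unfolding assms(5,6) using assms(4) by (simp add: power_mult_distrib flip: distrib_left)
  finally show r: "r = r'" using assms(1,2) by (simp add: power2_eq_iff_nonneg)
  show "c = c'" "s = s'" using assms r by simp_all
qed

text \<open>The radius is measured in the plane of \<open>X = e * x\<close> and \<open>y\<close>, so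
  the curve in the original plane is stretched by \<open>1 / e\<close> in the first coordinate. The
  assumption \<open>dir\<close> says that the radius depends on the direction only; it yields both
  the period 1 and the uniqueness of the curve point on each ray.\<close>

locale star_curve =
  fixes e :: real and \<sigma> :: "real \<Rightarrow> real"
  assumes e: "e > 0"
    and pos: "\<sigma> t > 0"
    and dir: "cos (2 * pi * t) = cos (2 * pi * t') \<Longrightarrow> sin (2 * pi * t) = sin (2 * pi * t') \<Longrightarrow> \<sigma> t = \<sigma> t'"
    and cont: "continuous_on UNIV \<sigma>"
begin

definition curve :: "real \<Rightarrow> real ^ 2" where
  "curve t = (\<sigma> t * cos (2 * pi * t) / e) *\<^sub>R axis 1 1 + (\<sigma> t * sin (2 * pi * t)) *\<^sub>R axis 2 1"

definition ray :: "real \<Rightarrow> complex" where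
  "ray t = Complex (cos (2 * pi * t) / e) (sin (2 * pi * t))"

definition ray' :: "real \<Rightarrow> complex" where
  "ray' t = Complex (- 2 * pi * sin (2 * pi * t) / e) (2 * pi * cos (2 * pi * t))"

lemma curve_nth [simp]:
  "curve t $ 1 = \<sigma> t * cos (2 * pi * t) / e" "curve t $ 2 = \<sigma> t * sin (2 * pi * t)"
  by (simp_all add: curve_def axis_def)

lemma curve_eq_scale:
  assumes "r > 0" "curve t' = r *\<^sub>R curve t"
  shows "r = 1" "cos (2 * pi * t') = cos (2 * pi * t)" "sin (2 * pi * t') = sin (2 * pi * t)"
proof -
  have "\<sigma> t' * cos (2 * pi * t') / e = (r * \<sigma> t) * cos (2 * pi * t) / e"
    "\<sigma> t' * sin (2 * pi * t') = (r * \<sigma> t) * sin (2 * pi * t)"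
    using arg_cong[OF assms(2), of "\<lambda>x. x $ 1"] arg_cong[OF assms(2), of "\<lambda>x. x $ 2"] by (simp_all add: mult.assoc)
  then have eqs: "\<sigma> t' * cos (2 * pi * t') = (r * \<sigma> t) * cos (2 * pi * t)"
    "\<sigma> t' * sin (2 * pi * t') = (r * \<sigma> t) * sin (2 * pi * t)"
    using e by simp_all
  note cancel = polar_cancel[OF _ _ _ _ eqs]
  have p: "\<sigma> t' > 0" "r * \<sigma> t > 0" using pos assms(1) by simp_all
  show cs: "cos (2 * pi * t') = cos (2 * pi * t)" "sin (2 * pi * t') = sin (2 * pi * t)"
    using cancel(2,3)[OF p sin_cos_squared_add2 sin_cos_squared_add2] by simp_all
  have "\<sigma> t' = r * \<sigma> t" using cancel(1)[OF p sin_cos_squared_add2 sin_cos_squared_add2] .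
  with dir[OF cs] pos[of t] show "r = 1" by simp
qed

lemma periodic: "\<sigma> (t + 1) = \<sigma> t" "curve (t + 1) = curve t"
proof -
  have *: "cos (2 * pi * (t + 1)) = cos (2 * pi * t)" "sin (2 * pi * (t + 1)) = sin (2 * pi * t)"
    by (simp_all add: distrib_left)
  show "\<sigma> (t + 1) = \<sigma> t" by (rule dir[OF *])
  then show "curve (t + 1) = curve t" unfolding curve_def * by simp
qed

lemma inside_curve:
  assumes "0 \<le> r" "r < 1"
  shows "r *\<^sub>R curve t \<in> inside (range curve)"
proof (rule inside_star_curve[of curve, OF _ periodic(2) _ _ curve_eq_scale(1) assms])
  show "continuous_on UNIV curve"
    unfolding curve_def[abs_def] using cont e by (intro continuous_intros) auto
  show "curve t \<noteq> 0" for t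
  proof
    assume "curve t = 0"
    then have "\<sigma> t * cos (2 * pi * t) / e = 0" "\<sigma> t * sin (2 * pi * t) = 0"
      using curve_nth[of t] by simp_all
    with e pos[of t] have "cos (2 * pi * t) = 0" "sin (2 * pi * t) = 0" by auto
    then show False using sin_cos_squared_add[of "2 * pi * t"] by simp
  qed
  show "\<exists>r\<ge>0. \<exists>t. x = r *\<^sub>R curve t" for x
  proof -
    \<comment> \<open>Undoing the stretching turns rays through the curve into ordinary polar rays,
      so \<open>Arg\<close> supplies the parameter.\<close>
    define z where "z = Complex (e * x $ 1) (x $ 2)"
    define t where "t = Arg z / (2 * pi)"
    have "z = rcis (cmod z) (Arg z)" by (simp add: rcis_cmod_Arg)
    then have "Re z = cmod z * cos (Arg z)" "Im z = cmod z * sin (Arg z)"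
      by (metis Re_rcis, metis Im_rcis)
    then have "e * x $ 1 = cmod z * cos (2 * pi * t)" "x $ 2 = cmod z * sin (2 * pi * t)"
      by (simp_all add: z_def t_def)
    then have "x = (cmod z / \<sigma> t) *\<^sub>R curve t"
      using pos[of t] e by (auto simp: vec_eq_iff forall_2 field_simps)
    then show ?thesis using pos[of t] by (intro exI[of _ "cmod z / \<sigma> t"]) (auto simp: less_imp_le)
  qed
qed

lemma ray_has_derivative: "(ray has_vector_derivative ray' t) (at t)"
proof -
  have "ray = (\<lambda>t. of_real (cos (2 * pi * t) / e) + \<i> * of_real (sin (2 * pi * t)))"
    by (rule ext) (simp add: ray_def complex_eq_iff)
  moreover have "((\<lambda>t. of_real (cos (2 * pi * t) / e) + \<i> * of_real (sin (2 * pi * t)))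
      has_vector_derivative ray' t) (at t)"
  proof -
    have c: "((\<lambda>t. complex_of_real (cos (2 * pi * t) / e)) has_vector_derivative
        complex_of_real (- 2 * pi * sin (2 * pi * t) / e)) (at t)"
      by (rule has_vector_derivative_of_real) (use e in \<open>auto intro!: derivative_eq_intros\<close>)
    have s: "((\<lambda>t. complex_of_real (sin (2 * pi * t))) has_vector_derivative
        complex_of_real (2 * pi * cos (2 * pi * t))) (at t)"
      by (rule has_vector_derivative_of_real) (auto intro!: derivative_eq_intros)
    have "ray' t = complex_of_real (- 2 * pi * sin (2 * pi * t) / e) + \<i> * complex_of_real (2 * pi * cos (2 * pi * t))"
      by (simp add: ray'_def complex_eq_iff)
    then show ?thesis
      using has_vector_derivative_add[OF c has_vector_derivative_mult_right[OF s, of \<i>]] by simp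
  qed
  ultimately show ?thesis by simp
qed

lemma smooth_loop_curve:
  assumes zero: "\<And>t. bih P Q (of_real (\<sigma> t) * ray t) = 0"
    and nondeg: "\<And>t. dbih P Q (of_real (\<sigma> t) * ray t) (ray t) \<noteq> 0"
  shows "smooth_loop (range curve)"
proof -
  \<comment> \<open>Everything needed is built from these three functions. The derivative of
    \<open>\<sigma>\<close> is the quotient of two members of the closure, with a nowhere vanishing
    denominator.\<close>
  define G where "G = {\<sigma>, \<lambda>t. cos (2 * pi * t), \<lambda>t. sin (2 * pi * t)}"
  have base: "\<sigma> \<in> diff_closure G" "(\<lambda>t. cos (2 * pi * t)) \<in> diff_closure G"
    "(\<lambda>t. sin (2 * pi * t)) \<in> diff_closure G"
    by (auto simp: G_def intro: diff_closure.base)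
  note closure = base diff_closure.const diff_closure.add diff_closure.mult diff_closure_minus diff_closure_diff
  have divide: "(\<lambda>t. f t / c) \<in> diff_closure G" if "f \<in> diff_closure G" for f c
    using diff_closure.mult[OF that diff_closure.const[of "inverse c"]] by (simp add: divide_inverse)
  have ray: "(\<lambda>t. Re (ray t)) \<in> diff_closure G" "(\<lambda>t. Im (ray t)) \<in> diff_closure G"
    "(\<lambda>t. Re (ray' t)) \<in> diff_closure G" "(\<lambda>t. Im (ray' t)) \<in> diff_closure G"
    unfolding ray_def ray'_def complex.sel by (intro closure divide)+
  have poly: "(\<lambda>t. Re (poly R (of_real (\<sigma> t) * ray t))) \<in> diff_closure G \<and>
      (\<lambda>t. Im (poly R (of_real (\<sigma> t) * ray t))) \<in> diff_closure G" for R
  proof (induction R)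
    case (pCons a R)
    then show ?case by (simp, intro conjI closure ray) auto
  qed (auto intro: closure)
  define Fs where "Fs s t = dbih P Q (of_real s * ray t) (ray t)" for s t
  define Ft where "Ft t = dbih P Q (of_real (\<sigma> t) * ray t) (of_real (\<sigma> t) * ray' t)" for t
  have Fs_closure: "(\<lambda>t. Fs (\<sigma> t) t) \<in> diff_closure G" and Ft_closure: "Ft \<in> diff_closure G"
    unfolding Fs_def Ft_def[abs_def] dbih_def times_complex.sel Re_complex_of_real Im_complex_of_real
    by (intro closure ray poly[THEN conjunct1] poly[THEN conjunct2])+
  have deriv: "(\<sigma> has_real_derivative - Ft t * inverse (Fs (\<sigma> t) t)) (at t)" for t
  proof -
    have "continuous_on UNIV ray"
      using ray_has_derivative by (intro continuous_at_imp_continuous_on ballI has_vector_derivative_continuous)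
    then have "continuous_on UNIV (\<lambda>(s, t). Fs s t)"
      unfolding Fs_def dbih_def case_prod_beta
      by (intro continuous_intros) (auto intro!: continuous_on_compose2[of UNIV ray] continuous_intros)
    then have contFs: "isCont (\<lambda>(s, t). Fs s t) x" for x
      by (metis UNIV_I continuous_on_eq_continuous_at open_UNIV)
    have "((\<lambda>s. of_real s * ray t) has_vector_derivative ray t) (at s)" for s t
      by (auto intro!: derivative_eq_intros simp: scaleR_conv_of_real[symmetric])
    from bih_has_real_derivative[OF this]
    have Fs: "((\<lambda>s. bih P Q (of_real s * ray t)) has_real_derivative Fs s t) (at s)" for s t
      unfolding Fs_def .
    have "((\<lambda>t'. of_real (\<sigma> t) * ray t') has_vector_derivative of_real (\<sigma> t) * ray' t) (at t)"
      by (intro has_vector_derivative_mult_right ray_has_derivative)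
    from bih_has_real_derivative[OF this]
    have Ft: "((\<lambda>t'. bih P Q (of_real (\<sigma> t) * ray t')) has_real_derivative Ft t) (at t)"
      unfolding Ft_def .
    have "isCont \<sigma> t" using cont by (simp add: continuous_on_eq_continuous_at)
    from implicit_derivative[OF zero this Fs contFs Ft] nondeg[of t]
    show ?thesis by (simp add: Fs_def divide_inverse)
  qed
  have G: "\<exists>f'\<in>diff_closure G. \<forall>t. (f has_real_derivative f' t) (at t)" if f: "f \<in> G" for f
  proof -
    consider "f = \<sigma>" | "f = (\<lambda>t. cos (2 * pi * t))" | "f = (\<lambda>t. sin (2 * pi * t))"
      using f unfolding G_def by blast
    then show ?thesis
    proof cases
      case 1
      show ?thesis unfolding 1
      proof (rule bexI[of _ "\<lambda>t. - Ft t * inverse (Fs (\<sigma> t) t)"])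
        show "(\<lambda>t. - Ft t * inverse (Fs (\<sigma> t) t)) \<in> diff_closure G"
          using nondeg by (intro closure Ft_closure diff_closure.inverse[OF Fs_closure]) (auto simp: Fs_def)
      qed (use deriv in blast)
    next
      case 2
      show ?thesis unfolding 2
        by (rule bexI[of _ "\<lambda>t. - (2 * pi) * sin (2 * pi * t)"])
          (auto intro!: derivative_eq_intros closure)
    next
      case 3
      show ?thesis unfolding 3
        by (rule bexI[of _ "\<lambda>t. (2 * pi) * cos (2 * pi * t)"])
          (auto intro!: derivative_eq_intros closure)
    qed
  qed
  have "smooth_curve curve"
    unfolding curve_def[abs_def]
    by (intro smooth_curve_diff_closure[OF G] closure divide)
  moreover have "inj_on curve {0..<1}"
  proof (rule inj_onI)
    fix t t' assume t: "t \<in> {0..<1}" "t' \<in> {0..<1}" and "curve t = curve t'"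
    then have "curve t = 1 *\<^sub>R curve t'" by simp
    from curve_eq_scale(2,3)[OF _ this]
    have "sin (2 * pi * t) = sin (2 * pi * t') \<and> cos (2 * pi * t) = cos (2 * pi * t')" by simp
    then obtain i :: int where "2 * pi * t = 2 * pi * t' + 2 * pi * of_int i"
      unfolding sin_cos_eq_iff by blast
    then have "2 * pi * t = 2 * pi * (t' + of_int i)" by (simp add: algebra_simps)
    then have i: "t = t' + of_int i" by simp
    with t have "of_int i < (1 :: real)" "of_int i > (-1 :: real)" by auto
    then have "i = 0" by linarith
    with i show "t = t'" by simp
  qed
  moreover have "vector_derivative curve (at t) \<noteq> 0" for t
  proof
    obtain \<sigma>' where \<sigma>': "(\<sigma> has_real_derivative \<sigma>') (at t)" using deriv by blast
    define c s where "c = cos (2 * pi * t)" and "s = sin (2 * pi * t)"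
    have "((\<lambda>t. \<sigma> t * cos (2 * pi * t)) has_real_derivative \<sigma>' * c - 2 * pi * \<sigma> t * s) (at t)"
      "((\<lambda>t. \<sigma> t * sin (2 * pi * t)) has_real_derivative \<sigma>' * s + 2 * pi * \<sigma> t * c) (at t)"
      by (auto intro!: derivative_eq_intros \<sigma>' simp: c_def s_def algebra_simps)
    from has_vector_derivative_scaleR_add[OF DERIV_cdivide[OF this(1), of e] this(2)]
    have "(curve has_vector_derivative ((\<sigma>' * c - 2 * pi * \<sigma> t * s) / e) *\<^sub>R axis 1 1 +
        (\<sigma>' * s + 2 * pi * \<sigma> t * c) *\<^sub>R axis 2 1) (at t)"
      unfolding curve_def[abs_def] .
    moreover assume "vector_derivative curve (at t) = 0"
    ultimately have "((\<sigma>' * c - 2 * pi * \<sigma> t * s) / e) *\<^sub>R axis 1 1 +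
        (\<sigma>' * s + 2 * pi * \<sigma> t * c) *\<^sub>R axis 2 1 = (0 :: real ^ 2)"
      by (metis vector_derivative_at)
    then have z: "\<sigma>' * c - 2 * pi * \<sigma> t * s = 0" "\<sigma>' * s + 2 * pi * \<sigma> t * c = 0"
      using e by (auto simp: vec_eq_iff forall_2 axis_def)
    \<comment> \<open>This combination isolates the angular part of the velocity:
      \<open>\<sigma>'\<close> drops out and \<open>2 * pi * \<sigma> t\<close>, which is positive,
      remains.\<close>
    have "c * (\<sigma>' * s + 2 * pi * \<sigma> t * c) - s * (\<sigma>' * c - 2 * pi * \<sigma> t * s) = 2 * pi * \<sigma> t * (c\<^sup>2 + s\<^sup>2)"
      by (simp add: algebra_simps power2_eq_square)
    then have "2 * pi * \<sigma> t * (c\<^sup>2 + s\<^sup>2) = 0" unfolding z by simp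
    moreover have "c\<^sup>2 + s\<^sup>2 = 1" by (simp add: c_def s_def)
    ultimately show False using pos[of t] by simp
  qed
  ultimately show ?thesis
    unfolding smooth_loop_def using periodic(2) by blast
qed

end

section \<open>The phase of the limit function\<close>

lemma cos_sin_arctan_quotient:
  fixes D E :: real
  assumes "D > 0"
  shows "D = sqrt (D\<^sup>2 + E\<^sup>2) * cos (arctan (E / D))" "E = sqrt (D\<^sup>2 + E\<^sup>2) * sin (arctan (E / D))"
proof -
  have "1 + (E / D)\<^sup>2 = (D\<^sup>2 + E\<^sup>2) / D\<^sup>2"
    using assms by (simp add: field_simps)
  then have *: "sqrt (1 + (E / D)\<^sup>2) = sqrt (D\<^sup>2 + E\<^sup>2) / D"
    using assms by (simp add: real_sqrt_divide)
  have "D\<^sup>2 + E\<^sup>2 > 0" using assms by (simp add: pos_add_strict add_pos_nonneg)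
  then show "D = sqrt (D\<^sup>2 + E\<^sup>2) * cos (arctan (E / D))" "E = sqrt (D\<^sup>2 + E\<^sup>2) * sin (arctan (E / D))"
    using assms by (simp_all add: cos_arctan sin_arctan *)
qed

text \<open>
  For \<open>y \<ge> 0\<close> this is the continuous argument of \<open>cos y + \<i> y sin y\<close>: its difference from the argument \<open>y\<close>
  of \<open>cos y + \<i> sin y\<close> stays below \<open>pi / 2\<close> in modulus and so is an arctangent.
\<close>

definition psi :: "real \<Rightarrow> real" where
  "psi y = y + arctan ((y - 1) * sin y * cos y / ((cos y)\<^sup>2 + y * (sin y)\<^sup>2))"

lemma psi_denominator_pos:
  assumes "y \<ge> 0"
  shows "(cos y)\<^sup>2 + y * (sin y)\<^sup>2 > (0::real)"
proof (cases "cos y = 0")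
  case True
  with assms have "y > 0" "sin y \<noteq> 0" using sin_cos_squared_add[of y] by (auto simp: less_le)
  with True show ?thesis by simp
next
  case False
  with assms show ?thesis by (simp add: add_pos_nonneg)
qed

lemma sum_squares_amplitude_pos: "(cos y)\<^sup>2 + y\<^sup>2 * (sin y)\<^sup>2 > (0::real)"
proof (cases "cos y = 0")
  case True
  then have "y \<noteq> 0" "sin y \<noteq> 0" using sin_cos_squared_add[of y] by auto
  with True show ?thesis by simp
next
  case False
  then show ?thesis by (simp add: add_pos_nonneg)
qed

text \<open>\<open>D + i E\<close> is the product of \<open>cos y + i y sin y\<close> and
  \<open>cos y - i sin y\<close>. As \<open>D > 0\<close>, its argument is
  \<open>arctan (E / D)\<close>, and multiplying back by \<open>cos y + i sin y\<close> adds
  \<open>y\<close>. The modulus is unchanged by the rotation.\<close>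

lemma psi_polar:
  assumes "y \<ge> 0"
  defines "\<rho> \<equiv> sqrt ((cos y)\<^sup>2 + y\<^sup>2 * (sin y)\<^sup>2)"
  shows "cos y = \<rho> * cos (psi y)" "y * sin y = \<rho> * sin (psi y)"
proof -
  define c s D E where "c = cos y" and "s = sin y"
    and "D = (cos y)\<^sup>2 + y * (sin y)\<^sup>2" and "E = (y - 1) * sin y * cos y"
  have cs: "c\<^sup>2 + s\<^sup>2 = 1" by (simp add: c_def s_def)
  have "D > 0" using psi_denominator_pos[OF assms(1)] by (simp add: D_def)
  note DE = cos_sin_arctan_quotient[OF this, of E]
  have D: "D = c\<^sup>2 + y * s\<^sup>2" and E: "E = (y - 1) * s * c" by (simp_all add: D_def E_def c_def s_def)
  have "D\<^sup>2 + E\<^sup>2 = (c\<^sup>2 + s\<^sup>2) * (c\<^sup>2 + y\<^sup>2 * s\<^sup>2)"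
    unfolding D E by (simp add: power2_eq_square algebra_simps)
  with cs have \<rho>: "\<rho> = sqrt (D\<^sup>2 + E\<^sup>2)" by (simp add: \<rho>_def c_def s_def)
  have psi: "psi y = y + arctan (E / D)" by (simp add: psi_def D_def E_def)
  have DE': "\<rho> * cos (arctan (E / D)) = D" "\<rho> * sin (arctan (E / D)) = E"
    using DE \<rho> by simp_all
  have "\<rho> * cos (psi y) = c * (\<rho> * cos (arctan (E / D))) - s * (\<rho> * sin (arctan (E / D)))"
    by (simp add: psi cos_add c_def s_def algebra_simps)
  also have "\<dots> = c * D - s * E" by (simp only: DE')
  also have "\<dots> = c * (c\<^sup>2 + s\<^sup>2)"
    unfolding D E by (simp add: power2_eq_square algebra_simps)
  finally show "cos y = \<rho> * cos (psi y)" unfolding cs by (simp add: c_def)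
  have "\<rho> * sin (psi y) = s * (\<rho> * cos (arctan (E / D))) + c * (\<rho> * sin (arctan (E / D)))"
    by (simp add: psi sin_add c_def s_def algebra_simps)
  also have "\<dots> = s * D + c * E" by (simp only: DE')
  also have "\<dots> = y * s * (c\<^sup>2 + s\<^sup>2)"
    unfolding D E by (simp add: power2_eq_square algebra_simps)
  finally show "y * sin y = \<rho> * sin (psi y)" unfolding cs by (simp add: s_def)
qed

lemma continuous_on_psi: "continuous_on {0..} psi"
  unfolding psi_def
  by (intro continuous_intros) (use psi_denominator_pos in force)

lemma psi_0 [simp]: "psi 0 = 0"
  by (simp add: psi_def)

lemma psi_ge: "psi y \<ge> y - pi / 2"
  using arctan_lbound[of "(y - 1) * sin y * cos y / ((cos y)\<^sup>2 + y * (sin y)\<^sup>2)"] by (simp add: psi_def)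

lemma add_sin_cos_pos: "y > 0 \<Longrightarrow> y + sin y * cos y > (0::real)"
proof (cases "sin y = 0")
  case False
  assume "y > 0"
  from False have "(sin y)\<^sup>2 > 0" by simp
  then have "(cos y)\<^sup>2 < 1" using sin_cos_squared_add[of y] by linarith
  then have "\<bar>cos y\<bar> < 1" by (simp add: abs_square_less_1)
  with False have "\<bar>sin y\<bar> * \<bar>cos y\<bar> < \<bar>sin y\<bar> * 1" by (intro mult_strict_left_mono) auto
  also have "\<dots> \<le> y" using abs_sin_x_le_abs_x[of y] \<open>y > 0\<close> by simp
  finally show ?thesis by (simp flip: abs_mult)
qed simp

text \<open>The quotient is \<open>(u v' - v u') / (u^2 + v^2)\<close> for \<open>u = cos y\<close>
  and \<open>v = y sin y\<close>; its numerator simplifies to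
  \<open>y + sin y * cos y\<close>.\<close>

lemma psi_has_derivative:
  assumes "y > 0"
  shows "(psi has_real_derivative (y + sin y * cos y) / ((cos y)\<^sup>2 + y\<^sup>2 * (sin y)\<^sup>2)) (at y)"
proof -
  define c s D E where "c = cos y" and "s = sin y"
    and "D = (cos y)\<^sup>2 + y * (sin y)\<^sup>2" and "E = (y - 1) * sin y * cos y"
  have cs: "c\<^sup>2 = 1 - s\<^sup>2" by (simp add: c_def s_def cos_squared_eq)
  have "D > 0" using psi_denominator_pos[of y] assms by (simp add: D_def)
  define D' E' where "D' = s\<^sup>2 + 2 * (y - 1) * s * c" and "E' = s * c + (y - 1) * (c\<^sup>2 - s\<^sup>2)"
  have dD: "((\<lambda>y. (cos y)\<^sup>2 + y * (sin y)\<^sup>2) has_real_derivative D') (at y)"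
    by (auto intro!: derivative_eq_intros simp: D'_def c_def s_def algebra_simps power2_eq_square)
  have dE: "((\<lambda>y. (y - 1) * sin y * cos y) has_real_derivative E') (at y)"
    by (auto intro!: derivative_eq_intros simp: E'_def c_def s_def algebra_simps power2_eq_square)
  have der: "(psi has_real_derivative 1 + (E' * D - E * D') / (D * D) / (1 + (E / D)\<^sup>2)) (at y)"
    using DERIV_add[OF DERIV_ident DERIV_chain2[OF DERIV_arctan DERIV_divide[OF dE dD]]] \<open>D > 0\<close>
    unfolding psi_def[abs_def] D_def E_def by (simp add: divide_inverse mult.commute mult.left_commute)
  have "D * D * (1 + (E / D)\<^sup>2) = D\<^sup>2 + E\<^sup>2"
    using \<open>D > 0\<close> by (simp add: field_simps power2_eq_square)
  then have q: "(E' * D - E * D') / (D * D) / (1 + (E / D)\<^sup>2) = (E' * D - E * D') / (D\<^sup>2 + E\<^sup>2)"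
    by (simp only: divide_divide_eq_left)
  have D: "D = 1 + (y - 1) * s\<^sup>2" and E: "E = (y - 1) * s * c"
    using cs by (simp_all add: D_def E_def c_def s_def algebra_simps)
  have "D\<^sup>2 + E\<^sup>2 = 1 + 2 * (y - 1) * s\<^sup>2 + (y - 1)\<^sup>2 * s\<^sup>2 * (s\<^sup>2 + c\<^sup>2)"
    unfolding D E by (simp add: power2_eq_square algebra_simps)
  also have "s\<^sup>2 + c\<^sup>2 = 1" using cs by simp
  also have "1 + 2 * (y - 1) * s\<^sup>2 + (y - 1)\<^sup>2 * s\<^sup>2 * 1 = c\<^sup>2 + y\<^sup>2 * s\<^sup>2"
    unfolding cs by (simp add: power2_eq_square algebra_simps)
  finally have DE: "D\<^sup>2 + E\<^sup>2 = c\<^sup>2 + y\<^sup>2 * s\<^sup>2" .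
  \<comment> \<open>The leading \<open>D\<^sup>2 + E\<^sup>2\<close> is the contribution of the
    summand \<open>y\<close> of \<open>psi y\<close>, whose derivative is 1, over the common
    denominator.\<close>
  have "D\<^sup>2 + E\<^sup>2 + (E' * D - E * D') =
      1 + (y - 1) * (s\<^sup>2 + c\<^sup>2) + s * c"
    unfolding D E D'_def E'_def by (simp add: power2_eq_square algebra_simps)
  then have n: "D\<^sup>2 + E\<^sup>2 + (E' * D - E * D') = y + s * c"
    using cs by simp
  have "c\<^sup>2 + y\<^sup>2 * s\<^sup>2 > 0" using sum_squares_amplitude_pos[of y] by (simp add: c_def s_def)
  then have "c\<^sup>2 + y\<^sup>2 * s\<^sup>2 \<noteq> 0" by simp
  then have "1 + (E' * D - E * D') / (D\<^sup>2 + E\<^sup>2) = (y + s * c) / (c\<^sup>2 + y\<^sup>2 * s\<^sup>2)"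
    unfolding n[symmetric] DE[symmetric] add_divide_distrib[of "D\<^sup>2 + E\<^sup>2"]
    by (subst divide_self) simp_all
  then show ?thesis
    using der unfolding q by (simp add: c_def s_def)
qed

section \<open>The polynomials with p + i q = (1 + i X^2)^M\<close>

lemma polar_squares:
  fixes X :: real
  shows "(sqrt (1 + X ^ 4) ^ M * cos t)\<^sup>2 + (sqrt (1 + X ^ 4) ^ M * sin t)\<^sup>2 = (1 + X ^ 4) ^ M"
proof -
  have "(sqrt (1 + X ^ 4) ^ M)\<^sup>2 = ((sqrt (1 + X ^ 4))\<^sup>2) ^ M"
    by (simp only: power_mult[symmetric] mult.commute)
  also have "(sqrt (1 + X ^ 4))\<^sup>2 = 1 + X ^ 4" by (simp add: add_nonneg_nonneg)
  finally show ?thesis by (simp only: power_mult_distrib distrib_left[symmetric] sin_cos_squared_add2 mult_1_right)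
qed

text \<open>Induction multiplies by \<open>1 + i X^2\<close>, of modulus
  \<open>sqrt (1 + X ^ 4)\<close> and argument \<open>arctan (X\<^sup>2)\<close>. The third conjunct
  says that the Wronskian is the squared modulus times the derivative
  \<open>2 M X / (1 + X^4)\<close> of the argument, cleared of the denominator.\<close>

lemma polar_polys:
  "\<exists>p q :: real poly. \<forall>X.
     poly p X = sqrt (1 + X ^ 4) ^ M * cos (real M * arctan (X\<^sup>2)) \<and>
     poly q X = sqrt (1 + X ^ 4) ^ M * sin (real M * arctan (X\<^sup>2)) \<and>
     (poly p X * poly (pderiv q) X - poly q X * poly (pderiv p) X) * (1 + X ^ 4) =
       2 * real M * X * (1 + X ^ 4) ^ M"
proof (induction M)
  case 0
  show ?case by (intro exI[of _ 1] exI[of _ 0]) auto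
next
  case (Suc M)
  then obtain p q where p: "\<And>X. poly p X = sqrt (1 + X ^ 4) ^ M * cos (real M * arctan (X\<^sup>2))"
    and q: "\<And>X. poly q X = sqrt (1 + X ^ 4) ^ M * sin (real M * arctan (X\<^sup>2))"
    and W: "\<And>X. (poly p X * poly (pderiv q) X - poly q X * poly (pderiv p) X) * (1 + X ^ 4) =
       2 * real M * X * (1 + X ^ 4) ^ M"
    by blast
  define x2 :: "real poly" where "x2 = [:0, 0, 1:]"
  have [simp]: "poly x2 X = X\<^sup>2" "poly (pderiv x2) X = 2 * X" for X
    by (simp_all add: x2_def pderiv_pCons power2_eq_square)
  have "poly (p - x2 * q) X = sqrt (1 + X ^ 4) ^ Suc M * cos (real (Suc M) * arctan (X\<^sup>2)) \<and>
     poly (q + x2 * p) X = sqrt (1 + X ^ 4) ^ Suc M * sin (real (Suc M) * arctan (X\<^sup>2)) \<and>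
     (poly (p - x2 * q) X * poly (pderiv (q + x2 * p)) X - poly (q + x2 * p) X * poly (pderiv (p - x2 * q)) X)
       * (1 + X ^ 4) = 2 * real (Suc M) * X * (1 + X ^ 4) ^ Suc M" (is "?A \<and> ?B \<and> ?C") for X
  proof (intro conjI)
    define S A where "S = sqrt (1 + X ^ 4)" and "A = arctan (X\<^sup>2)"
    have S: "S > 0" "S\<^sup>2 = 1 + X ^ 4" by (simp_all add: S_def add_pos_nonneg)
    have cs: "S * cos A = 1" "S * sin A = X\<^sup>2"
      using S by (simp_all add: A_def cos_arctan sin_arctan S_def flip: power_mult)
    have angle: "real (Suc M) * arctan (X\<^sup>2) = real M * A + A"
      by (simp add: A_def algebra_simps)
    have "poly (p - x2 * q) X = S ^ M * (cos (real M * A) * 1 - sin (real M * A) * X\<^sup>2)"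
      by (simp add: p q S_def A_def algebra_simps)
    also have "\<dots> = S ^ Suc M * cos (real M * A + A)"
      unfolding cos_add cs[symmetric] by (simp add: algebra_simps)
    finally show ?A unfolding angle S_def .
    have "poly (q + x2 * p) X = S ^ M * (sin (real M * A) * 1 + cos (real M * A) * X\<^sup>2)"
      by (simp add: p q S_def A_def algebra_simps)
    also have "\<dots> = S ^ Suc M * sin (real M * A + A)"
      unfolding sin_add cs[symmetric] by (simp add: algebra_simps)
    finally show ?B unfolding angle S_def .
    have sq: "(poly p X)\<^sup>2 + (poly q X)\<^sup>2 = (1 + X ^ 4) ^ M"
      unfolding p q by (rule polar_squares)
    have "(poly (p - x2 * q) X * poly (pderiv (q + x2 * p)) X - poly (q + x2 * p) X * poly (pderiv (p - x2 * q)) X)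
        = (poly p X * poly (pderiv q) X - poly q X * poly (pderiv p) X) * (1 + X ^ 4)
          + 2 * X * ((poly p X)\<^sup>2 + (poly q X)\<^sup>2)"
      by (simp add: pderiv_mult pderiv_add pderiv_diff algebra_simps power2_eq_square power4_eq_xxxx)
    then show ?C unfolding W sq by (simp add: algebra_simps)
  qed
  then show ?case by blast
qed

definition lim_re :: "real poly \<Rightarrow> real poly \<Rightarrow> real \<Rightarrow> real \<Rightarrow> real \<Rightarrow> real" where
  "lim_re p q s a b = poly p (s * a) * cos (s * b) - poly q (s * a) * (s * b * sin (s * b))"

text \<open>The imaginary part of \<open>(p + i q) (X) * (cos y + i y sin y)\<close> at
  \<open>X = s * a\<close>, \<open>y = s * b\<close>. It is the comparison function against which
  zeros of the approximant are counted along a ray.\<close>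

definition lim_im :: "real poly \<Rightarrow> real poly \<Rightarrow> real \<Rightarrow> real \<Rightarrow> real \<Rightarrow> real" where
  "lim_im p q s a b = poly q (s * a) * cos (s * b) + poly p (s * a) * (s * b * sin (s * b))"

definition dlim_re :: "real poly \<Rightarrow> real poly \<Rightarrow> real \<Rightarrow> real \<Rightarrow> real \<Rightarrow> real" where
  "dlim_re p q s a b = a * poly (pderiv p) (s * a) * cos (s * b) - b * poly p (s * a) * sin (s * b)
     - a * poly (pderiv q) (s * a) * (s * b * sin (s * b))
     - b * poly q (s * a) * (sin (s * b) + s * b * cos (s * b))"

definition dlim_im :: "real poly \<Rightarrow> real poly \<Rightarrow> real \<Rightarrow> real \<Rightarrow> real \<Rightarrow> real" where
  "dlim_im p q s a b = a * poly (pderiv q) (s * a) * cos (s * b) - b * poly q (s * a) * sin (s * b)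
     + a * poly (pderiv p) (s * a) * (s * b * sin (s * b))
     + b * poly p (s * a) * (sin (s * b) + s * b * cos (s * b))"

lemma lim_im_has_derivative:
  "((\<lambda>s. lim_im p q s a b) has_real_derivative dlim_im p q s a b) (at s)"
  unfolding lim_im_def[abs_def] dlim_im_def
  by (auto intro!: derivative_eq_intros simp: algebra_simps)

text \<open>The absolute value is harmless because \<open>cos y + i y sin y\<close> is even in
  \<open>y\<close>, and necessary because \<open>psi\<close> is the argument only for nonnegative
  \<open>y\<close>.\<close>

definition phase :: "nat \<Rightarrow> real \<Rightarrow> real \<Rightarrow> real \<Rightarrow> real" where
  "phase M s a b = real M * arctan ((s * a)\<^sup>2) + psi (s * \<bar>b\<bar>)"

locale polar_poly_pair =
  fixes M :: nat and p q :: "real poly"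
  assumes M: "M > 0"
    and p: "poly p X = sqrt (1 + X ^ 4) ^ M * cos (real M * arctan (X\<^sup>2))"
    and q: "poly q X = sqrt (1 + X ^ 4) ^ M * sin (real M * arctan (X\<^sup>2))"
    and W: "(poly p X * poly (pderiv q) X - poly q X * poly (pderiv p) X) * (1 + X ^ 4) =
       2 * real M * X * (1 + X ^ 4) ^ M"
begin

definition amp :: "real \<Rightarrow> real \<Rightarrow> real \<Rightarrow> real" where
  "amp s a b = sqrt (1 + (s * a) ^ 4) ^ M * sqrt ((cos (s * b))\<^sup>2 + (s * b)\<^sup>2 * (sin (s * b))\<^sup>2)"

lemma amp_pos: "amp s a b > 0"
  unfolding amp_def
  by (intro mult_pos_pos zero_less_power real_sqrt_gt_zero sum_squares_amplitude_pos) (simp add: add_pos_nonneg)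

lemma lim_polar:
  assumes "s \<ge> 0"
  shows "lim_re p q s a b = amp s a b * cos (phase M s a b)"
    and "lim_im p q s a b = amp s a b * sin (phase M s a b)"
proof -
  define y where "y = s * \<bar>b\<bar>"
  have y: "y \<ge> 0" using assms by (simp add: y_def)
  have sgn: "y = s * b \<or> y = - (s * b)" by (auto simp: y_def abs_if)
  then have *: "cos (s * b) = cos y" "s * b * sin (s * b) = y * sin y" "(s * b)\<^sup>2 = y\<^sup>2"
      "(sin (s * b))\<^sup>2 = (sin y)\<^sup>2"
    by auto
  note polar = psi_polar[OF y]
  show "lim_re p q s a b = amp s a b * cos (phase M s a b)"
    unfolding lim_re_def * p q phase_def amp_def y_def[symmetric] cos_add
    by (subst (1) polar(1), subst (1) polar(2)) (simp add: algebra_simps)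
  show "lim_im p q s a b = amp s a b * sin (phase M s a b)"
    unfolding lim_im_def * p q phase_def amp_def y_def[symmetric] sin_add
    by (subst (1) polar(1), subst (1) polar(2)) (simp add: algebra_simps)
qed

lemma pq_squares: "(poly p X)\<^sup>2 + (poly q X)\<^sup>2 = (1 + X ^ 4) ^ M"
  unfolding p q by (rule polar_squares)

text \<open>This is the squared amplitude times the radial derivative of the phase. Neither
  direction contributes negatively; the \<open>a\<close> part is positive when
  \<open>a \<noteq> 0\<close> and the \<open>b\<close> part when
  \<open>b \<noteq> 0\<close>.\<close>

lemma wronskian_pos:
  assumes "s > 0" "a\<^sup>2 + b\<^sup>2 = 1"
  shows "lim_re p q s a b * dlim_im p q s a b - lim_im p q s a b * dlim_re p q s a b > 0"
proof -
  define X y where "X = s * a" and "y = s * b"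
  define P Q P' Q' where "P = poly p X" and "Q = poly q X"
    and "P' = poly (pderiv p) X" and "Q' = poly (pderiv q) X"
  define C S where "C = cos y" and "S = sin y"
  have "lim_re p q s a b * dlim_im p q s a b - lim_im p q s a b * dlim_re p q s a b =
      (P * C - Q * (y * S)) * (a * Q' * C - b * Q * S + a * P' * (y * S) + b * P * (S + y * C))
      - (Q * C + P * (y * S)) * (a * P' * C - b * P * S - a * Q' * (y * S) - b * Q * (S + y * C))"
    by (simp add: lim_re_def dlim_im_def lim_im_def dlim_re_def P_def Q_def P'_def Q'_def C_def S_def
        flip: X_def y_def)
  \<comment> \<open>The Wronskian of a product of complex functions: each factor's own Wronskian is
    weighted by the squared modulus of the other factor.\<close>
  also have "\<dots> = a * (P * Q' - Q * P') * (C\<^sup>2 + y\<^sup>2 * S\<^sup>2)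
      + (P\<^sup>2 + Q\<^sup>2) * (b * (S * C + y * (S\<^sup>2 + C\<^sup>2)))"
    by (simp add: algebra_simps power2_eq_square)
  also have "S\<^sup>2 + C\<^sup>2 = 1" by (simp add: S_def C_def)
  also have "P\<^sup>2 + Q\<^sup>2 = (1 + X ^ 4) ^ M" by (simp add: P_def Q_def pq_squares)
  also have "P * Q' - Q * P' = 2 * real M * X * (1 + X ^ 4) ^ M / (1 + X ^ 4)"
  proof -
    have "1 + X ^ 4 \<noteq> 0" by (metis add_pos_nonneg less_irrefl zero_le_even_power zero_less_one even_numeral)
    with W[of X] show ?thesis by (simp add: P_def Q_def P'_def Q'_def field_simps)
  qed
  finally have eq: "lim_re p q s a b * dlim_im p q s a b - lim_im p q s a b * dlim_re p q s a b =
      (1 + X ^ 4) ^ M * (2 * real M * s * a\<^sup>2 / (1 + X ^ 4) * (C\<^sup>2 + y\<^sup>2 * S\<^sup>2) + b * (y * 1 + S * C))"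
    by (simp add: algebra_simps power2_eq_square X_def)
  have pos4: "1 + X ^ 4 > 0" by (simp add: add_pos_nonneg)
  have amp: "C\<^sup>2 + y\<^sup>2 * S\<^sup>2 > 0" using sum_squares_amplitude_pos[of y] by (simp add: C_def S_def)
  have t2: "b * (y * 1 + S * C) \<ge> 0 \<and> (b \<noteq> 0 \<longrightarrow> b * (y * 1 + S * C) > 0)"
  proof (cases b "0 :: real" rule: linorder_cases)
    case less
    then have "- y > 0" using assms by (simp add: y_def mult_pos_neg)
    from add_sin_cos_pos[OF this] have "y + S * C < 0" by (simp add: S_def C_def)
    with less show ?thesis by (simp add: mult_neg_neg less_imp_le)
  next
    case greater
    then have "y > 0" using assms by (simp add: y_def)
    from add_sin_cos_pos[OF this] have "y + S * C > 0" by (simp add: S_def C_def)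
    with greater show ?thesis by (simp add: less_imp_le)
  qed simp
  have t1: "2 * real M * s * a\<^sup>2 / (1 + X ^ 4) * (C\<^sup>2 + y\<^sup>2 * S\<^sup>2) \<ge> 0 \<and>
     (a \<noteq> 0 \<longrightarrow> 2 * real M * s * a\<^sup>2 / (1 + X ^ 4) * (C\<^sup>2 + y\<^sup>2 * S\<^sup>2) > 0)"
    using assms(1) M pos4 amp
    by (auto intro!: mult_nonneg_nonneg divide_nonneg_nonneg mult_pos_pos divide_pos_pos)
  have "a \<noteq> 0 \<or> b \<noteq> 0" using assms(2) by auto
  then have "2 * real M * s * a\<^sup>2 / (1 + X ^ 4) * (C\<^sup>2 + y\<^sup>2 * S\<^sup>2) + b * (y * 1 + S * C) > 0"
    using t1 t2 by (metis add_nonneg_pos add_pos_nonneg)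
  then show ?thesis unfolding eq using pos4 by (intro mult_pos_pos zero_less_power)
qed

end

section \<open>Growth of the phase along rays\<close>

lemma psi_strict_mono:
  assumes "0 \<le> x" "x < y"
  shows "psi x < psi y"
proof (rule DERIV_pos_imp_increasing_open[OF assms(2)])
  fix z assume "x < z" "z < y"
  with assms have "z > 0" by simp
  with psi_has_derivative[OF this] show "\<exists>d. (psi has_real_derivative d) (at z) \<and> d > 0"
    using add_sin_cos_pos sum_squares_amplitude_pos by (blast intro: divide_pos_pos)
next
  show "continuous_on {x..y} psi"
    by (rule continuous_on_subset[OF continuous_on_psi]) (use assms in auto)
qed

lemma psi_mono: "0 \<le> x \<Longrightarrow> x \<le> y \<Longrightarrow> psi x \<le> psi y"
  using psi_strict_mono[of x y] by (cases "x = y") auto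

lemma phase_0 [simp]: "phase M 0 a b = 0"
  by (simp add: phase_def)

lemma phase_strict_mono:
  assumes "M > 0" "a\<^sup>2 + b\<^sup>2 = 1" "0 \<le> s" "s < t"
  shows "phase M s a b < phase M t a b"
proof -
  have le1: "(s * a)\<^sup>2 \<le> (t * a)\<^sup>2"
    unfolding power_mult_distrib using assms by (intro mult_right_mono power_mono) auto
  have le2: "s * \<bar>b\<bar> \<le> t * \<bar>b\<bar>" using assms by (intro mult_right_mono) auto
  consider "a \<noteq> 0" | "b \<noteq> 0" using assms(2) by force
  then show ?thesis
  proof cases
    case 1
    with assms have "(s * a)\<^sup>2 < (t * a)\<^sup>2"
      unfolding power_mult_distrib by (intro mult_strict_right_mono power_strict_mono) auto
    then have "real M * arctan ((s * a)\<^sup>2) < real M * arctan ((t * a)\<^sup>2)"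
      using assms by (simp add: arctan_less_iff)
    moreover have "psi (s * \<bar>b\<bar>) \<le> psi (t * \<bar>b\<bar>)" using le2 assms by (intro psi_mono) auto
    ultimately show ?thesis by (simp add: phase_def)
  next
    case 2
    have "real M * arctan ((s * a)\<^sup>2) \<le> real M * arctan ((t * a)\<^sup>2)"
      using le1 by (intro mult_left_mono arctan_le_iff[THEN iffD2]) auto
    moreover have "psi (s * \<bar>b\<bar>) < psi (t * \<bar>b\<bar>)"
      using assms 2 by (intro psi_strict_mono mult_strict_right_mono) auto
    ultimately show ?thesis by (simp add: phase_def)
  qed
qed

text \<open>If \<open>a\<^sup>2 \<ge> 1 / 2\<close>, then \<open>(s * a)\<^sup>2 \<ge> 1\<close>, so
  the arctangent is at least \<open>pi / 4\<close> and \<open>M \<ge> 4 * n\<close> suffices.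
  Otherwise \<open>\<bar>b\<bar> \<ge> 1 / 2\<close>, so
  \<open>s * \<bar>b\<bar> \<ge> (n + 1) * pi\<close>, and \<open>psi\<close> lags behind its
  argument by at most \<open>pi / 2\<close>.\<close>

lemma phase_large:
  assumes "M \<ge> 4 * n" "s \<ge> 2" "s \<ge> 2 * (real n + 1) * pi" "a\<^sup>2 + b\<^sup>2 = 1"
  shows "phase M s a b \<ge> real n * pi"
proof (cases "a\<^sup>2 \<ge> 1 / 2")
  case True
  have "s\<^sup>2 \<ge> 2\<^sup>2" using assms by (intro power_mono) auto
  then have "s\<^sup>2 * a\<^sup>2 \<ge> 2\<^sup>2 * (1 / 2)" using True by (intro mult_mono) auto
  then have "arctan 1 \<le> arctan ((s * a)\<^sup>2)" unfolding arctan_le_iff power_mult_distrib by simp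
  then have "real (4 * n) * (pi / 4) \<le> real M * arctan ((s * a)\<^sup>2)"
    unfolding arctan_one using assms by (intro mult_mono) auto
  moreover have "psi 0 \<le> psi (s * \<bar>b\<bar>)" using assms by (intro psi_mono) auto
  ultimately show ?thesis by (simp add: phase_def)
next
  case False
  with assms have "b\<^sup>2 \<ge> (1 / 2)\<^sup>2" by (simp add: power2_eq_square)
  then have "\<bar>b\<bar> \<ge> 1 / 2" using power2_le_imp_le[of "1 / 2" "\<bar>b\<bar>"] by simp
  then have "2 * (real n + 1) * pi * (1 / 2) \<le> s * \<bar>b\<bar>" using assms by (intro mult_mono) auto
  moreover have "2 * (real n + 1) * pi * (1 / 2) = (real n + 1) * pi" by (simp add: field_simps)
  ultimately have "(real n + 1) * pi \<le> s * \<bar>b\<bar>" by (simp only:)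
  then have "psi (s * \<bar>b\<bar>) \<ge> real n * pi"
    using psi_ge[of "s * \<bar>b\<bar>"] pi_gt_zero unfolding distrib_right by linarith
  moreover have "real M * arctan ((s * a)\<^sup>2) \<ge> 0" by (simp add: zero_le_arctan_iff)
  ultimately show ?thesis unfolding phase_def by linarith
qed

lemma continuous_on_phase: "continuous_on ({0..} \<times> UNIV) (\<lambda>(s, a, b). phase M s a b)"
  unfolding phase_def case_prod_beta
  by (intro continuous_intros continuous_on_compose2[OF continuous_on_psi]) auto

section \<open>Approximation by biharmonic polynomials\<close>

definition exp_poly :: "nat \<Rightarrow> complex poly" where
  "exp_poly N = (\<Sum>k\<le>N. monom (1 / fact k) k)"

lemma poly_exp_poly: "poly (exp_poly N) z = (\<Sum>k\<le>N. z ^ k / fact k)"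
  by (simp add: exp_poly_def poly_sum poly_monom)

lemma poly_pderiv_exp_poly: "poly (pderiv (exp_poly N)) z = poly (exp_poly N) z - z ^ N / fact N"
proof (induction N)
  case 0
  show ?case by (simp add: exp_poly_def pderiv_monom)
next
  case (Suc N)
  have "exp_poly (Suc N) = exp_poly N + monom (1 / fact (Suc N)) (Suc N)"
    by (simp add: exp_poly_def)
  moreover have "pderiv (monom (1 / fact (Suc N)) (Suc N)) = monom (1 / fact N :: complex) N"
    by (simp add: pderiv_monom) (metis of_nat_Suc of_nat_neq_0)
  moreover have "poly (monom (1 / fact N) N) z = z ^ N / fact N" for N
    by (simp add: poly_monom)
  ultimately show ?case using Suc by (simp only: pderiv_add poly_add) simp
qed

abbreviation cpoly :: "real poly \<Rightarrow> complex poly" where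
  "cpoly \<equiv> map_poly complex_of_real"

lemma pderiv_cpoly: "pderiv (cpoly p) = cpoly (pderiv p)"
  by (rule poly_eqI) (simp add: coeff_pderiv coeff_map_poly)

lemma poly_cpoly_of_real: "poly (cpoly p) (complex_of_real x) = complex_of_real (poly p x)"
  by (induction p) (simp_all add: map_poly_pCons)

definition exp_times :: "real \<Rightarrow> nat \<Rightarrow> real poly \<Rightarrow> complex poly" where
  "exp_times e N p = exp_poly N * pcompose (cpoly p) [:0, complex_of_real e:]"

text \<open>
  Here \<open>\<tau>\<close> stands for the damped Taylor polynomial of \<open>exp\<close>, whose limit is \<open>cis y\<close>, and \<open>\<sigma>\<close> for the damped last
  term of that polynomial, whose limit is \<open>0\<close>. Treating them as independent variables
  makes \<open>C\<^sup>1\<close> convergence a matter of continuity on a compact set.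
\<close>

definition pert :: "real poly \<Rightarrow> real poly \<Rightarrow> real \<times> complex \<times> complex \<times> real \<times> real \<times> real \<Rightarrow> real" where
  "pert p q = (\<lambda>(e, \<tau>, \<sigma>, s, a, b).
     let z = of_real (s * a) + \<i> * of_real (e * s * b) in
     Re (\<tau> * poly (cpoly p) z) - s * b * Im (\<tau> * poly (cpoly q) z))"

text \<open>Differentiating the damped Taylor polynomial gives the damping factor times
  \<open>(a/e + i b) (T - L) - (a/e) T\<close>, with \<open>T\<close> the Taylor polynomial and
  \<open>L\<close> its last term. The two terms \<open>(a/e) T\<close> cancel, which leaves
  \<open>\<tau>'\<close>. No division by \<open>e\<close> remains, so \<open>e = 0\<close> is an
  admissible point of continuity.\<close>

definition dpert :: "real poly \<Rightarrow> real poly \<Rightarrow> real \<times> complex \<times> complex \<times> real \<times> real \<times> real \<Rightarrow> real" where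
  "dpert p q = (\<lambda>(e, \<tau>, \<sigma>, s, a, b).
     let z = of_real (s * a) + \<i> * of_real (e * s * b); d = of_real a + \<i> * of_real (e * b);
         \<tau>' = \<i> * of_real b * \<tau> - \<sigma> in
     Re (\<tau>' * poly (cpoly p) z + \<tau> * d * poly (cpoly (pderiv p)) z) - b * Im (\<tau> * poly (cpoly q) z)
     - s * b * Im (\<tau>' * poly (cpoly q) z + \<tau> * d * poly (cpoly (pderiv q)) z))"

lemma pert_limit: "pert p q (0, cis (s * b), 0, s, a, b) = lim_re p q s a b"
  by (simp add: pert_def lim_re_def poly_cpoly_of_real flip: of_real_mult)

lemma dpert_limit: "dpert p q (0, cis (s * b), 0, s, a, b) = dlim_re p q s a b"
  by (simp add: dpert_def dlim_re_def poly_cpoly_of_real algebra_simps flip: of_real_mult)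

definition scaled_exp :: "real \<Rightarrow> nat \<Rightarrow> real \<Rightarrow> real \<Rightarrow> real \<Rightarrow> complex" where
  "scaled_exp e N s a b = of_real (exp (- (s * a / e))) * poly (exp_poly N) (of_real s * Complex (a / e) b)"

text \<open>The last Taylor term appears because differentiating \<open>exp_poly N\<close> loses it.
  The factor \<open>Complex (a / e) b\<close>, which contains \<open>1 / e\<close>, is absorbed here
  so that smallness of the whole product is what has to be shown.\<close>

definition scaled_last :: "real \<Rightarrow> nat \<Rightarrow> real \<Rightarrow> real \<Rightarrow> real \<Rightarrow> complex" where
  "scaled_last e N s a b =
     Complex (a / e) b * of_real (exp (- (s * a / e))) * (of_real s * Complex (a / e) b) ^ N / fact N"

text \<open>The exponential factor keeps the values bounded as \<open>e\<close> tends to 0 without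
  moving any zero. At a zero of \<open>bih\<close> the radial derivative changes only by this
  positive factor.\<close>

definition damped :: "real \<Rightarrow> complex poly \<Rightarrow> complex poly \<Rightarrow> real \<Rightarrow> real \<Rightarrow> real \<Rightarrow> real" where
  "damped e P Q s a b = exp (- (s * a / e)) * bih P Q (of_real s * Complex (a / e) b)"

definition ddamped :: "real \<Rightarrow> complex poly \<Rightarrow> complex poly \<Rightarrow> real \<Rightarrow> real \<Rightarrow> real \<Rightarrow> real" where
  "ddamped e P Q s a b = exp (- (s * a / e)) *
     (dbih P Q (of_real s * Complex (a / e) b) (Complex (a / e) b) - a / e * bih P Q (of_real s * Complex (a / e) b))"

lemma damped_has_derivative:
  "((\<lambda>s. damped e P Q s a b) has_real_derivative ddamped e P Q s a b) (at s)"
proof -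
  have "((\<lambda>s. of_real s * Complex (a / e) b) has_vector_derivative Complex (a / e) b) (at s)"
    by (auto intro!: derivative_eq_intros simp: scaleR_conv_of_real[symmetric])
  note d = bih_has_real_derivative[OF this, of P Q]
  have dE: "((\<lambda>s. exp (- (s * a / e))) has_real_derivative exp (- (s * a / e)) * (- (a / e))) (at s)"
    by (rule DERIV_cong, rule DERIV_fun_exp, rule DERIV_minus, rule DERIV_cdivide, rule DERIV_cmult_right, rule DERIV_ident) simp
  show ?thesis
    unfolding damped_def[abs_def] ddamped_def
    by (rule DERIV_cong[OF DERIV_mult[OF dE d]]) (simp add: algebra_simps)
qed

lemma damped_eq_pert:
  fixes N :: nat and p q :: "real poly" and a b s e :: real
  assumes "e \<noteq> 0"
  defines "P \<equiv> exp_times e N p" and "Q \<equiv> - exp_times e N q"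
  defines "x \<equiv> (e, scaled_exp e N s a b, scaled_last e N s a b, s, a, b)"
  shows "damped e P Q s a b = pert p q x" and "ddamped e P Q s a b = dpert p q x"
proof -
  define \<zeta> where "\<zeta> = Complex (a / e) b"
  define z where "z = of_real s * \<zeta>"
  define T L E where "T = poly (exp_poly N) z" and "L = z ^ N / fact N" and "E = exp (- (s * a / e))"
  define w where "w = of_real (s * a) + \<i> * of_real (e * s * b)"
  define d where "d = of_real a + \<i> * of_real (e * b)"
  have w: "of_real e * z = w" and d: "of_real e * \<zeta> = d"
    using assms(1) by (auto simp: z_def \<zeta>_def w_def d_def complex_eq_iff)
  have Im: "Im z = s * b" "Im \<zeta> = b" by (simp_all add: z_def \<zeta>_def)
  have poly: "poly (exp_times e N r) z = T * poly (cpoly r) w" for r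
    using w by (simp add: exp_times_def poly_pcompose T_def mult.commute)
  have dpoly: "poly (pderiv (exp_times e N r)) z = (T - L) * poly (cpoly r) w + T * of_real e * poly (cpoly (pderiv r)) w" for r
    using w by (simp add: exp_times_def poly_pcompose T_def L_def mult.commute pderiv_mult pderiv_pcompose
        pderiv_cpoly poly_pderiv_exp_poly pderiv_pCons algebra_simps)
  have \<tau>: "scaled_exp e N s a b = E * T" and \<sigma>: "scaled_last e N s a b = E * (\<zeta> * L)"
    by (simp_all add: scaled_exp_def scaled_last_def E_def T_def L_def z_def \<zeta>_def)
  have Re_rmult: "Re (complex_of_real r * u) = r * Re u" and Im_rmult: "Im (complex_of_real r * u) = r * Im u"
    for r u by simp_all
  show "damped e P Q s a b = pert p q x"
    unfolding damped_def \<zeta>_def[symmetric] z_def[symmetric] E_def[symmetric] bih_def P_def Q_def x_def pert_def prod.case Let_def w_def[symmetric] \<tau>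
    by (simp only: poly_minus poly Im mult.assoc Re_rmult Im_rmult uminus_complex.sel)
       (simp add: algebra_simps)
  \<comment> \<open>Here the cancellation of the terms with \<open>a / e\<close> takes place; it is
    the reason why the derivative also has a limit.\<close>
  have step: "poly (pderiv (exp_times e N r)) z * \<zeta> - of_real (a / e) * poly (exp_times e N r) z =
      (\<i> * of_real b * T - \<zeta> * L) * poly (cpoly r) w + T * d * poly (cpoly (pderiv r)) w" for r
  proof -
    have "\<zeta> - of_real (a / e) = \<i> * of_real b" by (simp add: \<zeta>_def complex_eq_iff)
    then have "\<zeta> * T - of_real (a / e) * T = \<i> * of_real b * T" by (simp only: left_diff_distrib[symmetric])
    moreover have "((T - L) * R + T * of_real e * R') * \<zeta> - c * (T * R) =
        (\<zeta> * T - c * T) * R - \<zeta> * L * R + T * (of_real e * \<zeta>) * R'" for R R' c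
      by (simp add: algebra_simps)
    ultimately show ?thesis unfolding poly dpoly d[symmetric] by (simp only:) (simp add: algebra_simps)
  qed
  have rearrange: "A + b * - B + s * b * - C - k * (D + s * b * - F) = A - k * D - b * B - s * b * (C - k * F)"
    for A B C D F k :: real
    by (simp add: algebra_simps)
  have "dbih P Q z \<zeta> - a / e * bih P Q z =
      Re (poly (pderiv (exp_times e N p)) z * \<zeta> - of_real (a / e) * poly (exp_times e N p) z)
      - b * Im (poly (exp_times e N q) z)
      - s * b * Im (poly (pderiv (exp_times e N q)) z * \<zeta> - of_real (a / e) * poly (exp_times e N q) z)"
    unfolding bih_def dbih_def P_def Q_def Im pderiv_minus poly_minus minus_complex.sel uminus_complex.sel Re_rmult Im_rmult
      mult_minus_left
    by (rule rearrange)
  also have "E * \<dots> =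
      Re (of_real E * ((\<i> * of_real b * T - \<zeta> * L) * poly (cpoly p) w + T * d * poly (cpoly (pderiv p)) w))
      - b * Im (of_real E * (T * poly (cpoly q) w))
      - s * b * Im (of_real E * ((\<i> * of_real b * T - \<zeta> * L) * poly (cpoly q) w + T * d * poly (cpoly (pderiv q)) w))"
  proof -
    have "E * (A - b * B - s * b * C) = E * A - b * (E * B) - s * b * (E * C)" for A B C
      by (simp add: algebra_simps)
    then show ?thesis unfolding step unfolding poly Re_rmult Im_rmult .
  qed
  also have "\<dots> = dpert p q x"
  proof -
    have "of_real E * ((\<i> * of_real b * T - \<zeta> * L) * R + T * d * R') =
        (\<i> * of_real b * (E * T) - E * (\<zeta> * L)) * R + E * T * d * R'" for R R'
      by (simp add: algebra_simps)
    then show ?thesis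
      unfolding x_def dpert_def prod.case Let_def w_def[symmetric] d_def[symmetric] \<tau> \<sigma> by (simp only: mult.assoc)
  qed
  finally show "ddamped e P Q s a b = dpert p q x"
    unfolding ddamped_def \<zeta>_def[symmetric] z_def[symmetric] E_def[symmetric] .
qed

lemma continuous_on_pert [continuous_intros]: "continuous_on A (pert p q)"
  unfolding pert_def Let_def case_prod_beta by (intro continuous_intros)

lemma continuous_on_dpert [continuous_intros]: "continuous_on A (dpert p q)"
  unfolding dpert_def Let_def case_prod_beta by (intro continuous_intros)

text \<open>With \<open>e\<close> fixed, \<open>z\<close> ranges over a bounded set, so the damping
  factor is bounded and a large \<open>N\<close> makes the Taylor remainder small even after
  damping. The single degree \<open>N\<close> must also serve the last term.\<close>

lemma scaled_exp_approx:
  assumes "e > 0" "\<delta> > 0"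
  shows "\<exists>N. \<forall>s a b. 0 \<le> s \<longrightarrow> s \<le> S \<longrightarrow> a\<^sup>2 + b\<^sup>2 = 1 \<longrightarrow>
    norm (scaled_exp e N s a b - cis (s * b)) < \<delta> \<and> norm (scaled_last e N s a b) < \<delta>"
proof -
  define R0 R where "R0 = 1 / e + 1" and "R = \<bar>S\<bar> * R0"
  have R: "R0 > 0" "R \<ge> 0" using assms by (simp_all add: R0_def R_def add_pos_pos add_nonneg_nonneg)
  \<comment> \<open>One constant for both errors: the remainder is at most
    \<open>exp R * (exp R * R * F)\<close>, and the last term at most \<open>R0 * exp R * F\<close>,
    with \<open>F = R ^ N / fact N\<close>.\<close>
  define K where "K = exp (2 * R) * (R + R0)"
  have "(\<lambda>N. K * (inverse (fact N) * R ^ N)) \<longlonglongrightarrow> K * 0"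
    by (intro tendsto_intros summable_LIMSEQ_zero[OF summable_exp])
  then have "\<forall>\<^sub>F N in sequentially. K * (inverse (fact N) * R ^ N) < \<delta>"
    using assms(2) by (intro order_tendstoD(2)) simp_all
  then obtain N where N: "K * (inverse (fact N) * R ^ N) < \<delta>"
    by (auto simp: eventually_sequentially)
  define F where "F = R ^ N / fact N"
  have F: "F \<ge> 0" "K * F < \<delta>" using N R by (simp_all add: F_def field_simps)
  show ?thesis
  proof (intro exI[of _ N] allI impI)
    fix s a b :: real
    assume s: "0 \<le> s" "s \<le> S" and ab: "a\<^sup>2 + b\<^sup>2 = 1"
    have "a\<^sup>2 \<le> 1" "b\<^sup>2 \<le> 1"
      using ab zero_le_power2[of a] zero_le_power2[of b] by linarith+
    then have ab1: "\<bar>a\<bar> \<le> 1" "\<bar>b\<bar> \<le> 1"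
      by (simp_all add: abs_square_le_1)
    define \<zeta> where "\<zeta> = Complex (a / e) b"
    define z where "z = of_real s * \<zeta>"
    have "norm \<zeta> \<le> \<bar>a / e\<bar> + \<bar>b\<bar>" using cmod_le[of \<zeta>] by (simp add: \<zeta>_def)
    also have "\<dots> \<le> R0" using ab1 assms(1) by (simp add: R0_def field_simps add_mono)
    finally have \<zeta>: "norm \<zeta> \<le> R0" .
    have z: "norm z \<le> R" unfolding z_def R_def norm_mult using s \<zeta> by (intro mult_mono) auto
    have ReIm: "Re z = s * a / e" "Im z = s * b" by (simp_all add: z_def \<zeta>_def)
    have "- (s * a / e) \<le> R" using z abs_Re_le_cmod[of z] ReIm by linarith
    then have E: "exp (- (s * a / e)) \<le> exp R" by simp
    have zN: "norm z ^ N / fact N \<le> F" unfolding F_def using z by (intro divide_right_mono power_mono) auto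
    have "cis (s * b) = of_real (exp (- (s * a / e))) * exp z"
      by (simp add: exp_eq_polar ReIm exp_minus)
    then have "scaled_exp e N s a b - cis (s * b) =
        - (of_real (exp (- (s * a / e))) * (exp z - (\<Sum>k\<le>N. z ^ k / fact k)))"
      by (simp add: scaled_exp_def poly_exp_poly z_def \<zeta>_def algebra_simps)
    then have "norm (scaled_exp e N s a b - cis (s * b)) =
        exp (- (s * a / e)) * norm (exp z - (\<Sum>k\<le>N. z ^ k / fact k))"
      by (simp add: norm_mult)
    also have "\<dots> \<le> exp R * (exp R * R * F)"
    proof (intro mult_mono E)
      have "norm (exp z - (\<Sum>k\<le>N. z ^ k / fact k)) \<le> exp \<bar>Re z\<bar> * (norm z * (norm z ^ N / fact N))"
        using Taylor_exp[of z N] by simp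
      also have "\<dots> \<le> exp R * (R * F)"
      proof (intro mult_mono zN z)
        show "exp \<bar>Re z\<bar> \<le> exp R" using z abs_Re_le_cmod[of z] by simp
      qed (use R F in auto)
      finally show "norm (exp z - (\<Sum>k\<le>N. z ^ k / fact k)) \<le> exp R * R * F" by simp
    qed auto
    also have "\<dots> \<le> K * F"
      unfolding K_def mult_2 exp_add using R F by (simp add: algebra_simps)
    finally have 1: "norm (scaled_exp e N s a b - cis (s * b)) < \<delta>" using F by simp
    have "norm (scaled_last e N s a b) = norm \<zeta> * exp (- (s * a / e)) * (norm z ^ N / fact N)"
      by (simp add: scaled_last_def norm_mult norm_divide norm_power z_def \<zeta>_def)
    also have "\<dots> \<le> R0 * exp R * F"
      using \<zeta> E zN R F by (intro mult_mono) auto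
    also have "\<dots> \<le> K * F"
    proof (rule mult_right_mono)
      have "R0 * exp R \<le> (R + R0) * exp (2 * R)" using R by (intro mult_mono) auto
      then show "R0 * exp R \<le> K" by (simp add: K_def mult.commute)
    qed (use F in simp)
    finally show "norm (scaled_exp e N s a b - cis (s * b)) < \<delta> \<and> norm (scaled_last e N s a b) < \<delta>"
      using 1 F by simp
  qed
qed

context polar_poly_pair
begin

text \<open>Both inequalities are open conditions on the arguments of \<open>pert\<close> and hold
  on the compact set of limit points, hence on a uniform neighbourhood of it. The bound
  \<open>phase M s a b \<ge> pi / 4\<close> keeps away from \<open>s = 0\<close>, where the
  Wronskian vanishes.\<close>

lemma good_approximation:
  "\<exists>P Q e. e > 0 \<and> (\<forall>s a b. 0 \<le> s \<longrightarrow> s \<le> S \<longrightarrow> a\<^sup>2 + b\<^sup>2 = 1 \<longrightarrow> phase M s a b \<ge> pi / 4 \<longrightarrow>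
    damped e P Q s a b * dlim_im p q s a b - lim_im p q s a b * ddamped e P Q s a b > 0 \<and>
    4 * (damped e P Q s a b - lim_re p q s a b)\<^sup>2 < (amp s a b)\<^sup>2)"
proof -
  define K where "K = ({0..S} \<times> {-1..1} \<times> {-1..1}) \<inter>
    {(s, a, b). a\<^sup>2 + b\<^sup>2 = 1 \<and> phase M s a b \<ge> pi / 4}"
  have "compact K"
  proof -
    have 1: "closed (({0..} \<times> UNIV) \<inter> (\<lambda>(s, a, b). phase M s a b) -` {pi / 4..})"
      by (intro continuous_closed_preimage continuous_on_phase closed_Times) auto
    have 2: "closed {(s :: real, a :: real, b :: real). a\<^sup>2 + b\<^sup>2 = 1}"
      unfolding case_prod_beta by (intro closed_Collect_eq continuous_intros)
    have "compact (({0..S} \<times> {-1..1} \<times> {-1..1}) \<inter>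
        ((({0..} \<times> UNIV) \<inter> (\<lambda>(s, a, b). phase M s a b) -` {pi / 4..}) \<inter> {(s, a, b). a\<^sup>2 + b\<^sup>2 = 1}))"
      by (intro compact_Int_closed compact_Times compact_Icc closed_Int 1 2)
    also have "\<dots> = K" by (auto simp: K_def)
    finally show ?thesis .
  qed
  define G where "G = (\<lambda>(s, a, b). (0 :: real, cis (s * b), 0 :: complex, s, a, b)) ` K"
  have "compact G"
    unfolding G_def case_prod_beta
    by (intro compact_continuous_image continuous_intros \<open>compact K\<close>)
  define U where "U = {x. (case x of (e, \<tau>, \<sigma>, s, a, b) \<Rightarrow>
      pert p q x * dlim_im p q s a b - lim_im p q s a b * dpert p q x > 0 \<and>
      4 * (pert p q x - lim_re p q s a b)\<^sup>2 < (lim_re p q s a b)\<^sup>2 + (lim_im p q s a b)\<^sup>2)}"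
  have "open U"
    unfolding U_def case_prod_beta lim_re_def lim_im_def dlim_im_def
    by (intro open_Collect_conj open_Collect_less continuous_intros)
  have "G \<subseteq> U"
  proof
    fix x assume "x \<in> G"
    then obtain s a b where x: "x = (0, cis (s * b), 0, s, a, b)" and sab: "0 \<le> s" "a\<^sup>2 + b\<^sup>2 = 1"
      and ph: "phase M s a b \<ge> pi / 4"
      by (auto simp: G_def K_def)
    have "s \<noteq> 0"
    proof
      assume "s = 0"
      with ph have "pi / 4 \<le> 0" by simp
      with pi_gt_zero show False by linarith
    qed
    with sab have s: "s > 0" by simp
    have "(lim_re p q s a b)\<^sup>2 + (lim_im p q s a b)\<^sup>2 = (amp s a b)\<^sup>2 * 1"
      unfolding lim_polar[OF sab(1)] power_mult_distrib distrib_left[symmetric] by simp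
    then show "x \<in> U"
      using wronskian_pos[OF s sab(2)] amp_pos[of s a b]
      by (simp add: U_def x pert_limit dpert_limit)
  qed
  with compact_subset_open_imp_ball_epsilon_subset[OF \<open>compact G\<close> \<open>open U\<close>]
  obtain \<epsilon> where \<epsilon>: "\<epsilon> > 0" "(\<Union>x\<in>G. ball x \<epsilon>) \<subseteq> U" by blast
  \<comment> \<open>The three components \<open>e\<close>, \<open>scaled_exp\<close> and
    \<open>scaled_last\<close> each deviate by at most \<open>e\<close>, so their total
    \<open>3 * e\<close> stays below \<open>\<epsilon>\<close>.\<close>
  define e where "e = \<epsilon> / 4"
  have e: "e > 0" using \<epsilon> by (simp add: e_def)
  obtain N where N: "\<And>s a b. 0 \<le> s \<Longrightarrow> s \<le> S \<Longrightarrow> a\<^sup>2 + b\<^sup>2 = 1 \<Longrightarrow>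
    norm (scaled_exp e N s a b - cis (s * b)) < e \<and> norm (scaled_last e N s a b) < e"
    using scaled_exp_approx[OF e e, of S] by blast
  define P Q where "P = exp_times e N p" and "Q = - exp_times e N q"
  show ?thesis
  proof (rule exI[of _ P], rule exI[of _ Q], rule exI[of _ e], intro conjI allI impI e)
    fix s a b :: real
    assume s: "0 \<le> s" "s \<le> S" and ab: "a\<^sup>2 + b\<^sup>2 = 1" and ph: "phase M s a b \<ge> pi / 4"
    have "a\<^sup>2 \<le> 1" "b\<^sup>2 \<le> 1"
      using ab zero_le_power2[of a] zero_le_power2[of b] by linarith+
    then have ab1: "\<bar>a\<bar> \<le> 1" "\<bar>b\<bar> \<le> 1"
      by (simp_all add: abs_square_le_1)
    define g where "g = (0 :: real, cis (s * b), 0 :: complex, s, a, b)"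
    define x where "x = (e, scaled_exp e N s a b, scaled_last e N s a b, s, a, b)"
    have "(s, a, b) \<in> K" using s ab ph ab1 by (auto simp: K_def)
    then have "g \<in> G" unfolding G_def g_def by (intro image_eqI[of _ _ "(s, a, b)"]) simp_all
    have "dist g x = norm (x - g)" by (simp add: dist_norm norm_minus_commute)
    also have "x - g = (e, scaled_exp e N s a b - cis (s * b), scaled_last e N s a b, 0, 0, 0)"
      by (simp add: x_def g_def zero_prod_def)
    also have "norm \<dots> \<le> e + (e + e)"
    proof -
      define u v where "u = scaled_exp e N s a b - cis (s * b)" and "v = scaled_last e N s a b"
      have "norm (0 :: real, 0 :: real, 0 :: real) = 0" by (simp add: norm_Pair del: norm_eq_zero)
      then have "norm (e, u, v, 0 :: real, 0 :: real, 0 :: real) \<le> norm e + (norm u + norm v)"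
        using norm_Pair_le[of e "(u, v, 0 :: real, 0 :: real, 0 :: real)"]
          norm_Pair_le[of u "(v, 0 :: real, 0 :: real, 0 :: real)"]
          norm_Pair_le[of v "(0 :: real, 0 :: real, 0 :: real)"] by linarith
      moreover have "norm u \<le> e" "norm v \<le> e" "norm e = e"
        using N[OF s ab] e by (simp_all add: u_def v_def)
      ultimately show ?thesis unfolding u_def v_def by linarith
    qed
    also have "\<dots> < \<epsilon>" using \<epsilon>(1) by (simp add: e_def)
    finally have "x \<in> ball g \<epsilon>" by simp
    with \<epsilon>(2) \<open>g \<in> G\<close> have "x \<in> U" by blast
    have sq: "(lim_re p q s a b)\<^sup>2 + (lim_im p q s a b)\<^sup>2 = (amp s a b)\<^sup>2 * 1"
      unfolding lim_polar[OF s(1)] power_mult_distrib distrib_left[symmetric] by simp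
    have "damped e P Q s a b = pert p q x" "ddamped e P Q s a b = dpert p q x"
      using damped_eq_pert[of e N p q s a b] e by (simp_all add: P_def Q_def x_def)
    moreover have "pert p q x * dlim_im p q s a b - lim_im p q s a b * dpert p q x > 0 \<and>
        4 * (pert p q x - lim_re p q s a b)\<^sup>2 < (amp s a b)\<^sup>2"
      using \<open>x \<in> U\<close> by (simp add: U_def x_def sq)
    ultimately show "damped e P Q s a b * dlim_im p q s a b - lim_im p q s a b * ddamped e P Q s a b > 0"
      "4 * (damped e P Q s a b - lim_re p q s a b)\<^sup>2 < (amp s a b)\<^sup>2"
      by simp_all
  qed
qed

end

section \<open>The nested loops\<close>

lemma zero_between_unique:
  fixes f :: "real \<Rightarrow> real"
  assumes "lo < hi" "f lo > 0" "f hi < 0"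
    and deriv: "\<And>x. lo \<le> x \<Longrightarrow> x \<le> hi \<Longrightarrow> \<exists>d<0. (f has_real_derivative d) (at x)"
  shows "\<exists>!x. lo \<le> x \<and> x \<le> hi \<and> f x = 0"
proof -
  have anti: "f y < f x" if "lo \<le> x" "x < y" "y \<le> hi" for x y
  proof (rule DERIV_neg_imp_decreasing[OF that(2)])
    fix z assume "x \<le> z" "z \<le> y"
    with that have "lo \<le> z" "z \<le> hi" by auto
    from deriv[OF this] show "\<exists>d. (f has_real_derivative d) (at z) \<and> d < 0" by blast
  qed
  have "continuous_on {lo..hi} f"
    using deriv by (intro continuous_at_imp_continuous_on ballI) (auto dest!: DERIV_isCont)
  then have "\<exists>x\<ge>lo. x \<le> hi \<and> f x = 0"
    using assms by (intro IVT2') auto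
  then obtain x where "lo \<le> x \<and> x \<le> hi \<and> f x = 0" by blast
  then show ?thesis
  proof (rule ex1I)
    fix y assume y: "lo \<le> y \<and> y \<le> hi \<and> f y = 0"
    with anti[of x y] anti[of y x] \<open>lo \<le> x \<and> x \<le> hi \<and> f x = 0\<close> show "y = x"
      by (cases x y rule: linorder_cases) auto
  qed
qed

context polar_poly_pair
begin

text \<open>The positive zeros of the cosine, hence the phases at which the limit function
  vanishes.\<close>

definition level :: "nat \<Rightarrow> real" where
  "level k = real k * pi - pi / 2"

lemma cos_sin_near_level:
  assumes "\<bar>d\<bar> \<le> pi / 4"
  shows "sin (level k + d) = sin (level k) * cos d" "cos (level k + d) = - sin (level k) * sin d"
    "sin (level k + d) \<noteq> 0" "\<bar>sin (level k)\<bar> = 1"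
proof -
  have c: "cos (level k) = 0" by (simp add: level_def cos_diff)
  then show *: "sin (level k + d) = sin (level k) * cos d" "cos (level k + d) = - sin (level k) * sin d"
    by (simp_all add: sin_add cos_add)
  have "(sin (level k))\<^sup>2 = 1" using sin_cos_squared_add[of "level k"] c by simp
  then show s: "\<bar>sin (level k)\<bar> = 1" unfolding power2_eq_1_iff by auto
  have "cos d > 0" using assms pi_gt_zero by (intro cos_gt_zero_pi) linarith+
  with s * show "sin (level k + d) \<noteq> 0" by auto
qed

end

text \<open>\<open>M\<close> and \<open>S\<close> are the values for which
  \<open>phase_large\<close> makes the phase reach \<open>n * pi\<close> at \<open>s = S\<close> in
  every direction, enough room for \<open>n\<close> levels. The threshold \<open>pi / 4\<close> in
  \<open>good\<close> is the lower end of the band around \<open>level 1\<close>.\<close>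

locale approximate_solution = polar_poly_pair +
  fixes n :: nat and S e :: real and P Q :: "complex poly"
  assumes Mn: "M = 4 * n" and S: "S = 2 * (real n + 1) * pi" and e: "e > 0"
    and good: "0 \<le> s \<Longrightarrow> s \<le> S \<Longrightarrow> a\<^sup>2 + b\<^sup>2 = 1 \<Longrightarrow> phase M s a b \<ge> pi / 4 \<Longrightarrow>
      damped e P Q s a b * dlim_im p q s a b - lim_im p q s a b * ddamped e P Q s a b > 0 \<and>
      4 * (damped e P Q s a b - lim_re p q s a b)\<^sup>2 < (amp s a b)\<^sup>2"
begin

text \<open>Within \<open>pi / 4\<close> of a level the function \<open>lim_im\<close> cannot
  vanish, and bands of different levels are disjoint. The inequalities are weak so that the relation
  is closed.\<close>

definition on_loop :: "nat \<Rightarrow> real \<Rightarrow> real \<Rightarrow> real \<Rightarrow> bool" where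
  "on_loop k a b s \<longleftrightarrow> 0 \<le> s \<and> s \<le> S \<and> \<bar>phase M s a b - level k\<bar> \<le> pi / 4 \<and>
     bih P Q (of_real s * Complex (a / e) b) = 0"

lemma on_loop_props:
  assumes "k \<ge> 1" "a\<^sup>2 + b\<^sup>2 = 1" "on_loop k a b s"
  shows "s > 0" "dbih P Q (of_real s * Complex (a / e) b) (Complex (a / e) b) \<noteq> 0"
proof -
  have k: "1 * pi \<le> real k * pi" using assms(1) by (intro mult_right_mono) auto
  have s: "0 \<le> s" "s \<le> S" "\<bar>phase M s a b - level k\<bar> \<le> pi / 4"
    and z: "bih P Q (of_real s * Complex (a / e) b) = 0"
    using assms(3) by (simp_all add: on_loop_def)
  have ph: "phase M s a b \<ge> pi / 4" using s(3) k unfolding level_def by linarith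
  have "s \<noteq> 0"
  proof
    assume "s = 0"
    with ph have "pi / 4 \<le> 0" by simp
    with pi_gt_zero show False by linarith
  qed
  with s show "s > 0" by simp
  \<comment> \<open>At a zero the Wronskian inequality reduces to
    \<open>- lim_im * ddamped > 0\<close>, and \<open>ddamped\<close> is then a multiple of
    \<open>dbih\<close>.\<close>
  show "dbih P Q (of_real s * Complex (a / e) b) (Complex (a / e) b) \<noteq> 0"
    using good[OF s(1,2) assms(2) ph] unfolding damped_def ddamped_def z by auto
qed

text \<open>The band around \<open>level k\<close> is an interval \<open>lo..hi\<close> of radii,
  since the phase increases along the ray. On it the quotient of approximant and
  \<open>lim_im\<close> decreases strictly from a positive to a negative value.\<close>

lemma ex1_on_loop:
  assumes "1 \<le> k" "k \<le> n" "a\<^sup>2 + b\<^sup>2 = 1"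
  shows "\<exists>!s. on_loop k a b s"
proof -
  have k: "1 * pi \<le> real k * pi" "real k * pi \<le> real n * pi"
    using assms by (intro mult_right_mono; simp)+
  have M0: "M > 0" by (rule M)
  have S2: "S \<ge> 2" "S \<ge> 0"
  proof -
    have "2 * 1 * 2 \<le> S" unfolding S using pi_ge_two by (intro mult_mono) auto
    then show "S \<ge> 2" "S \<ge> 0" by auto
  qed
  have mono: "phase M s a b < phase M t a b \<longleftrightarrow> s < t" if "0 \<le> s" "0 \<le> t" for s t
    using phase_strict_mono[OF M0 assms(3), of s t] phase_strict_mono[OF M0 assms(3), of t s] that
    by (cases s t rule: linorder_cases) auto
  have cont: "continuous_on {0..S} (\<lambda>s. phase M s a b)"
  proof -
    have "continuous_on {0..S} (\<lambda>s. (\<lambda>(s, a, b). phase M s a b) (s, a, b))"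
      by (rule continuous_on_compose2[OF continuous_on_phase]) (auto intro!: continuous_intros)
    then show ?thesis by simp
  qed
  have large: "phase M S a b \<ge> real n * pi"
    using phase_large[of n M S a b] S2 Mn S assms(3) by simp
  have attain: "\<exists>s. 0 \<le> s \<and> s \<le> S \<and> phase M s a b = y" if "0 \<le> y" "y \<le> real n * pi" for y
    using IVT'[of "\<lambda>s. phase M s a b" 0 y S] that large S2 cont by auto
  have "0 \<le> level k + - (pi / 4)" "level k + - (pi / 4) \<le> real n * pi"
    "0 \<le> level k + pi / 4" "level k + pi / 4 \<le> real n * pi"
    using k pi_gt_zero unfolding level_def by linarith+
  note ends_attained = attain[OF this(1,2)] attain[OF this(3,4)]
  obtain lo where lo: "0 \<le> lo" "lo \<le> S" "phase M lo a b = level k + - (pi / 4)"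
    using ends_attained(1) by blast
  obtain hi where hi: "0 \<le> hi" "hi \<le> S" "phase M hi a b = level k + pi / 4"
    using ends_attained(2) by blast
  have "lo < hi" using mono[OF lo(1) hi(1)] lo(3) hi(3) pi_gt_zero by simp
  define f f' where "f = (\<lambda>s. damped e P Q s a b)" and "f' = (\<lambda>s. ddamped e P Q s a b)"
  have near: "\<bar>phase M s a b - level k\<bar> \<le> pi / 4 \<longleftrightarrow> lo \<le> s \<and> s \<le> hi" if "0 \<le> s" for s
  proof -
    have m: "phase M s a b < level k + - (pi / 4) \<longleftrightarrow> s < lo" "level k + pi / 4 < phase M s a b \<longleftrightarrow> hi < s"
      using mono[OF that lo(1)] mono[OF hi(1) that] unfolding lo(3) hi(3) .
    have "\<bar>phase M s a b - level k\<bar> \<le> pi / 4 \<longleftrightarrow>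
        \<not> phase M s a b < level k + - (pi / 4) \<and> \<not> level k + pi / 4 < phase M s a b"
      by (rule iffI) linarith+
    then show ?thesis unfolding m by (simp only: not_less)
  qed
  have good': "f s * dlim_im p q s a b - lim_im p q s a b * f' s > 0"
      "4 * (f s - lim_re p q s a b)\<^sup>2 < (amp s a b)\<^sup>2"
    if "lo \<le> s" "s \<le> hi" for s
  proof -
    have s: "0 \<le> s" "s \<le> S" using that lo hi by auto
    then have "phase M s a b \<ge> pi / 4" using near[OF s(1)] that k unfolding level_def by linarith
    from good[OF s assms(3) this]
    show "f s * dlim_im p q s a b - lim_im p q s a b * f' s > 0"
      "4 * (f s - lim_re p q s a b)\<^sup>2 < (amp s a b)\<^sup>2"
      unfolding f_def f'_def by blast+
  qed
  have im: "lim_im p q s a b \<noteq> 0" if "lo \<le> s" "s \<le> hi" for s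
  proof -
    have s: "0 \<le> s" using that lo by auto
    have "\<bar>phase M s a b - level k\<bar> \<le> pi / 4" using near[OF s] that by simp
    from cos_sin_near_level(3)[OF this, of k] show ?thesis
      using amp_pos[of s a b] by (simp add: lim_polar[OF s])
  qed
  have df: "(f has_real_derivative f' s) (at s)" for s
    unfolding f_def f'_def by (rule damped_has_derivative)
  define g where "g s = f s / lim_im p q s a b" for s
  have dg: "\<exists>d<0. (g has_real_derivative d) (at s)" if "lo \<le> s" "s \<le> hi" for s
  proof (intro exI conjI)
    show "(g has_real_derivative (f' s * lim_im p q s a b - f s * dlim_im p q s a b) /
        (lim_im p q s a b * lim_im p q s a b)) (at s)"
      unfolding g_def[abs_def] by (intro DERIV_divide df lim_im_has_derivative im that)
    show "(f' s * lim_im p q s a b - f s * dlim_im p q s a b) /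
        (lim_im p q s a b * lim_im p q s a b) < 0"
      using good'(1)[OF that] im[OF that]
      by (intro divide_neg_pos) (auto simp: algebra_simps not_square_less_zero zero_less_mult_iff)
  qed
  \<comment> \<open>In the limit the quotient is the cotangent of \<open>level k + d\<close>, that
    is \<open>- tan d\<close>, equal to 1 or -1 at the ends. The error is below 1 because
    \<open>\<bar>f s - lim_re\<bar>\<close> is less than half the amplitude, while
    \<open>\<bar>lim_im\<bar>\<close> is the amplitude divided by \<open>sqrt 2\<close>.\<close>
  have ends: "\<bar>f s / lim_im p q s a b + tan d\<bar> < 1"
    if s: "lo \<le> s" "s \<le> hi" and d: "phase M s a b = level k + d" "\<bar>d\<bar> = pi / 4" for s d
  proof -
    have s0: "0 \<le> s" using s lo by auto
    have d': "\<bar>d\<bar> \<le> pi / 4" using d by simp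
    note near = cos_sin_near_level[OF d', of k]
    define A where "A = amp s a b"
    have A: "A > 0" by (simp add: A_def amp_pos)
    have cosd: "cos d = sqrt 2 / 2" using d(2) cos_45 by (metis cos_abs_real)
    have absim: "\<bar>lim_im p q s a b\<bar> = A * (sqrt 2 / 2)"
      using A near(4) unfolding lim_polar[OF s0] d(1) near(1,2) A_def[symmetric]
      by (simp add: abs_mult cosd)
    have "lim_re p q s a b = - tan d * lim_im p q s a b"
      unfolding lim_polar[OF s0] d(1) near(1,2) tan_def by (simp add: cosd)
    then have "f s / lim_im p q s a b + tan d = (f s - lim_re p q s a b) / lim_im p q s a b"
      using im[OF s] by (simp add: field_simps)
    moreover have "\<bar>f s - lim_re p q s a b\<bar> < \<bar>lim_im p q s a b\<bar>"
    proof (rule power2_less_imp_less[of _ "\<bar>lim_im p q s a b\<bar>"])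
      have "\<bar>lim_im p q s a b\<bar>\<^sup>2 = A\<^sup>2 / 2"
        unfolding absim by (simp add: power_mult_distrib power_divide)
      then show "\<bar>f s - lim_re p q s a b\<bar>\<^sup>2 < \<bar>lim_im p q s a b\<bar>\<^sup>2"
        using good'(2)[OF s] zero_le_power2[of A] unfolding A_def[symmetric] power2_abs by linarith
    qed simp
    ultimately show ?thesis using im[OF s] by (simp add: abs_divide)
  qed
  have "g lo > 0"
    using ends[of lo "- (pi / 4)"] lo(3) \<open>lo < hi\<close> pi_gt_zero by (simp add: g_def tan_45 abs_less_iff)
  moreover have "g hi < 0"
    using ends[of hi "pi / 4"] hi(3) \<open>lo < hi\<close> pi_gt_zero by (simp add: g_def tan_45 abs_less_iff)
  ultimately have ex1: "\<exists>!s. lo \<le> s \<and> s \<le> hi \<and> g s = 0"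
    using zero_between_unique[OF \<open>lo < hi\<close> _ _ dg] by blast
  have "on_loop k a b s \<longleftrightarrow> lo \<le> s \<and> s \<le> hi \<and> g s = 0" for s
  proof (cases "lo \<le> s \<and> s \<le> hi")
    case True
    with lo hi have s: "0 \<le> s" "s \<le> S" by auto
    with True near[OF s(1)] im show ?thesis by (simp add: on_loop_def g_def f_def damped_def)
  next
    case False
    with near[of s] show ?thesis by (auto simp: on_loop_def)
  qed
  with ex1 show ?thesis by simp
qed

section \<open>Radius functions and the loops they trace\<close>

definition radius :: "nat \<Rightarrow> real \<Rightarrow> real" where
  "radius k t = (THE s. on_loop k (cos (2 * pi * t)) (sin (2 * pi * t)) s)"

lemma on_loop_iff:
  assumes "1 \<le> k" "k \<le> n"
  shows "on_loop k (cos (2 * pi * t)) (sin (2 * pi * t)) s \<longleftrightarrow> s = radius k t"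
proof -
  have "(cos (2 * pi * t))\<^sup>2 + (sin (2 * pi * t))\<^sup>2 = 1" by simp
  from ex1_on_loop[OF assms this] show ?thesis
    unfolding radius_def by (intro iffI) (erule the1_equality[symmetric], assumption, erule ssubst, rule theI')
qed

text \<open>By uniqueness \<open>on_loop\<close> is the graph of \<open>radius k\<close>. It is cut
  out by an equation and weak inequalities, hence closed, and its values lie in the compact interval
  \<open>{0..S}\<close>.\<close>

lemma continuous_radius:
  assumes "1 \<le> k" "k \<le> n"
  shows "continuous_on UNIV (radius k)"
proof (rule continuous_from_closed_graph[of "{0..S}"])
  show "radius k \<in> UNIV \<rightarrow> {0..S}"
  proof
    fix t
    have "on_loop k (cos (2 * pi * t)) (sin (2 * pi * t)) (radius k t)"
      using on_loop_iff[OF assms] by blast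
    then show "radius k t \<in> {0..S}" by (simp add: on_loop_def)
  qed
  have c1: "closed {x :: real \<times> real. 0 \<le> snd x}" and c2: "closed {x :: real \<times> real. snd x \<le> S}"
    by (intro closed_Collect_le continuous_intros)+
  have c3: "closed {x :: real \<times> real. bih P Q (of_real (snd x) *
      (of_real (cos (2 * pi * fst x) / e) + \<i> * of_real (sin (2 * pi * fst x)))) = 0}"
    using e unfolding bih_def by (intro closed_Collect_eq continuous_intros) auto
  have c4: "closed ({x :: real \<times> real. 0 \<le> snd x} \<inter>
      (\<lambda>x. \<bar>phase M (snd x) (cos (2 * pi * fst x)) (sin (2 * pi * fst x)) - level k\<bar>) -` {..pi / 4})"
  proof (rule continuous_closed_preimage)
    have "continuous_on {x :: real \<times> real. 0 \<le> snd x}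
        (\<lambda>x. (\<lambda>(s, a, b). phase M s a b) (snd x, cos (2 * pi * fst x), sin (2 * pi * fst x)))"
      by (rule continuous_on_compose2[OF continuous_on_phase]) (auto intro!: continuous_intros)
    then show "continuous_on {x :: real \<times> real. 0 \<le> snd x}
        (\<lambda>x. \<bar>phase M (snd x) (cos (2 * pi * fst x)) (sin (2 * pi * fst x)) - level k\<bar>)"
      by (intro continuous_intros) simp
    show "closed {x :: real \<times> real. 0 \<le> snd x}" by fact
  qed simp
  have "closed ({x :: real \<times> real. 0 \<le> snd x} \<inter> {x. snd x \<le> S} \<inter>
      {x. bih P Q (of_real (snd x) * (of_real (cos (2 * pi * fst x) / e) + \<i> * of_real (sin (2 * pi * fst x)))) = 0} \<inter>
      ({x. 0 \<le> snd x} \<inter>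
      (\<lambda>x. \<bar>phase M (snd x) (cos (2 * pi * fst x)) (sin (2 * pi * fst x)) - level k\<bar>) -` {..pi / 4}))"
    by (intro closed_Int c1 c2 c3 c4)
  also have "\<dots> = {(t, s). on_loop k (cos (2 * pi * t)) (sin (2 * pi * t)) s}"
    by (auto simp: on_loop_def Complex_eq)
  also have "\<dots> = (\<lambda>t. (t, radius k t)) ` UNIV"
    unfolding on_loop_iff[OF assms] by auto
  finally show "closed ((\<lambda>t. (t, radius k t)) ` UNIV)" .
qed simp

lemma star_curve_radius:
  assumes "1 \<le> k" "k \<le> n"
  shows "star_curve e (radius k)"
proof
  show "radius k t > 0" for t
  proof -
    have "on_loop k (cos (2 * pi * t)) (sin (2 * pi * t)) (radius k t)" using on_loop_iff[OF assms] by blast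
    from on_loop_props(1)[OF assms(1) _ this] show ?thesis by simp
  qed
  show "radius k t = radius k t'" if "cos (2 * pi * t) = cos (2 * pi * t')" "sin (2 * pi * t) = sin (2 * pi * t')" for t t'
    by (simp add: radius_def that)
qed (use e continuous_radius[OF assms] in auto)

definition loop :: "nat \<Rightarrow> (real ^ 2) set" where
  "loop k = range (star_curve.curve e (radius k))"

lemma smooth_loop_loop:
  assumes "1 \<le> k" "k \<le> n"
  shows "smooth_loop (loop k)" "loop k \<subseteq> (\<lambda>x. bih P Q (Complex (x $ 1) (x $ 2))) -` {0}"
proof -
  interpret star_curve e "radius k" by (rule star_curve_radius[OF assms])
  have on: "on_loop k (cos (2 * pi * t)) (sin (2 * pi * t)) (radius k t)" for t
    using on_loop_iff[OF assms] by blast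
  have "bih P Q (of_real (radius k t) * ray t) = 0"
    "dbih P Q (of_real (radius k t) * ray t) (ray t) \<noteq> 0" for t
    using on[of t] on_loop_props(2)[OF assms(1) _ on[of t]] by (simp_all add: on_loop_def ray_def)
  then show "smooth_loop (loop k)" unfolding loop_def by (rule smooth_loop_curve)
  have "Complex (curve t $ 1) (curve t $ 2) = of_real (radius k t) * Complex (cos (2 * pi * t) / e) (sin (2 * pi * t))" for t
    by (simp add: complex_eq_iff)
  with on show "loop k \<subseteq> (\<lambda>x. bih P Q (Complex (x $ 1) (x $ 2))) -` {0}"
    by (auto simp: loop_def on_loop_def simp del: curve_nth)
qed

text \<open>A common point has one direction and one radius, hence one phase. This phase is within
  \<open>pi / 4\<close> of both levels, whereas distinct levels differ by at least
  \<open>pi\<close>.\<close>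

lemma disjoint_loops:
  assumes k: "1 \<le> k" "k \<le> n" and j: "1 \<le> j" "j \<le> n" and "loop k \<inter> loop j \<noteq> {}"
  shows "k = j"
proof -
  interpret K: star_curve e "radius k" by (rule star_curve_radius[OF k])
  interpret J: star_curve e "radius j" by (rule star_curve_radius[OF j])
  obtain t t' where eq: "K.curve t = J.curve t'" using assms(5) by (auto simp: loop_def)
  have "radius k t * cos (2 * pi * t) = radius j t' * cos (2 * pi * t')"
    "radius k t * sin (2 * pi * t) = radius j t' * sin (2 * pi * t')"
    using arg_cong[OF eq, of "\<lambda>x. x $ 1"] arg_cong[OF eq, of "\<lambda>x. x $ 2"] e by simp_all
  note c = polar_cancel[OF K.pos J.pos sin_cos_squared_add2 sin_cos_squared_add2 this]
  have "on_loop k (cos (2 * pi * t)) (sin (2 * pi * t)) (radius k t)"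
    "on_loop j (cos (2 * pi * t')) (sin (2 * pi * t')) (radius j t')"
    using on_loop_iff k j by blast+
  then have "\<bar>level k - level j\<bar> \<le> pi / 2"
    unfolding c on_loop_def by linarith
  then have "\<bar>real k - real j\<bar> * pi \<le> (1 / 2) * pi"
    by (simp add: level_def abs_mult flip: left_diff_distrib)
  then have "\<bar>real k - real j\<bar> \<le> 1 / 2"
    by (rule mult_right_le_imp_le) simp
  then show ?thesis by linarith
qed

text \<open>On each ray the phase on loop \<open>k\<close> is at most
  \<open>level k + pi / 4\<close>, below the band of loop \<open>k + 1\<close>. Monotonicity of the
  phase orders the radii, and the star shape of the outer loop does the rest.\<close>

lemma nested_loops:
  assumes "1 \<le> k" "k < n"
  shows "loop k \<subseteq> inside (loop (k + 1))"
proof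
  define j where "j = k + 1"
  have k: "k \<le> n" "1 \<le> j" "j \<le> n" using assms by (auto simp: j_def)
  interpret K: star_curve e "radius k" by (rule star_curve_radius[OF assms(1) k(1)])
  interpret J: star_curve e "radius j" by (rule star_curve_radius[OF k(2,3)])
  fix x assume "x \<in> loop k"
  then obtain t where x: "x = K.curve t" by (auto simp: loop_def)
  let ?a = "cos (2 * pi * t)" and ?b = "sin (2 * pi * t)"
  have "on_loop k ?a ?b (radius k t)" "on_loop j ?a ?b (radius j t)"
    using on_loop_iff[OF assms(1) k(1)] on_loop_iff[OF k(2,3)] by blast+
  then have "phase M (radius k t) ?a ?b < phase M (radius j t) ?a ?b"
    using pi_gt_zero unfolding on_loop_def level_def j_def of_nat_add distrib_right of_nat_1 mult_1 by linarith
  then have less: "radius k t < radius j t"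
    using phase_strict_mono[OF M _ less_imp_le[OF J.pos], of ?a ?b t "radius k t"]
    by (cases "radius k t" "radius j t" rule: linorder_cases) auto
  define r where "r = radius k t / radius j t"
  have r: "0 \<le> r" "r < 1" using less K.pos[of t] J.pos[of t] by (simp_all add: r_def)
  have "x = r *\<^sub>R J.curve t"
    using J.pos[of t] e by (simp add: x vec_eq_iff forall_2 r_def)
  with J.inside_curve[OF r] show "x \<in> inside (loop (k + 1))" by (simp add: loop_def j_def)
qed

text \<open>A vanishing function would have zero radial derivative, but on the first loop, which
  exists because \<open>n \<ge> 1\<close>, that derivative is nonzero. The ray along the positive
  first axis is used.\<close>

lemma bih_nonzero:
  assumes "n \<ge> 1"
  shows "(\<lambda>x :: real ^ 2. bih P Q (Complex (x $ 1) (x $ 2))) \<noteq> (\<lambda>x. 0)"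
proof
  assume zero: "(\<lambda>x :: real ^ 2. bih P Q (Complex (x $ 1) (x $ 2))) = (\<lambda>x. 0)"
  have z: "bih P Q w = 0" for w
    using fun_cong[OF zero, of "vector [Re w, Im w]"] by (simp add: vector_2)
  obtain s where s: "on_loop 1 1 0 s" using ex1_on_loop[of 1 1 0] assms by auto
  have "((\<lambda>s. of_real s * Complex (1 / e) 0) has_vector_derivative Complex (1 / e) 0) (at s)"
    by (auto intro!: derivative_eq_intros simp: scaleR_conv_of_real[symmetric])
  from bih_has_real_derivative[OF this, of P Q]
  have "dbih P Q (of_real s * Complex (1 / e) 0) (Complex (1 / e) 0) = 0"
    unfolding z by (metis DERIV_const DERIV_unique)
  with on_loop_props(2)[OF _ _ s] show False by simp
qed

end

theorem theorem1p1:
  fixes n :: nat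
  assumes "n \<ge> 1"
  shows "\<exists>u :: real ^ 2 \<Rightarrow> real. biharmonic_polynomial u \<and> u \<noteq> (\<lambda>x. 0) \<and>
    (\<exists>L :: nat \<Rightarrow> (real ^ 2) set.
       (\<forall>k\<in>{1..n}. smooth_loop (L k) \<and> L k \<subseteq> u -` {0}) \<and>
       disjoint_family_on L {1..n} \<and>
       (\<forall>k\<in>{1..<n}. L k \<subseteq> inside (L (k + 1))))"
proof -
  obtain p q where "polar_poly_pair (4 * n) p q"
    using polar_polys[of "4 * n"] assms unfolding polar_poly_pair_def by auto
  then interpret polar_poly_pair "4 * n" p q .
  define S where "S = 2 * (real n + 1) * pi"
  obtain P Q e where "approximate_solution (4 * n) p q n S e P Q"
    using good_approximation[of S] \<open>polar_poly_pair (4 * n) p q\<close> S_def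
    unfolding approximate_solution_def approximate_solution_axioms_def by blast
  then interpret approximate_solution "4 * n" p q n S e P Q .
  define u where "u = (\<lambda>x :: real ^ 2. bih P Q (Complex (x $ 1) (x $ 2)))"
  have "biharmonic_polynomial u" unfolding u_def by (rule biharmonic_bih)
  moreover have "u \<noteq> (\<lambda>x. 0)" unfolding u_def by (rule bih_nonzero[OF assms])
  moreover have "\<forall>k\<in>{1..n}. smooth_loop (loop k) \<and> loop k \<subseteq> u -` {0}"
    using smooth_loop_loop unfolding u_def by simp
  moreover have "disjoint_family_on loop {1..n}"
    unfolding disjoint_family_on_def
  proof (intro ballI impI)
    fix k j assume "k \<in> {1..n}" "j \<in> {1..n}" "k \<noteq> j"
    with disjoint_loops[of k j] show "loop k \<inter> loop j = {}" by auto
  qed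
  moreover have "\<forall>k\<in>{1..<n}. loop k \<subseteq> inside (loop (k + 1))"
    using nested_loops by simp
  ultimately show ?thesis by blast
qed

end
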